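(* Independent Set and Clique can be solved in time $2^k\cdot n^{O(1)}$ and polynomial space on $n$-vertex graphs $G=(V,E)$ given together with a set $X\subseteq V$, $|X|\le k$, such that $G\setminus X$ is an interval graph.
   Context: Independent Set (resp. Clique): given $G$ and a positive integer $p$, decide whether $G$ has a set of $p$ pairwise nonadjacent (resp. pairwise adjacent) vertices. *)

theory Defs
  imports
    "Graph_Theory.Pair_Digraph"
    "Graph_Theory.Digraph_Component"
    "HOL-Library.Discrete_Functions"
    "HOL-Library.Landau_Symbols"
begin

section \<open>Graphs\<close>

text \<open>
  A finite simple undirected graph is a finite, loop-free, symmetric digraph without parallel
  arcs, i.e. \<^const>\<open>pair_graph\<close>; every edge is present as a pair of opposite arcs.
\<close>

definition independent_in :: "('a, 'b) pre_digraph \<Rightarrow> 'a set \<Rightarrow> bool" where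
  "independent_in G S \<longleftrightarrow> S \<subseteq> verts G \<and> (\<forall>u\<in>S. \<forall>v\<in>S. u \<noteq> v \<longrightarrow> \<not> u \<rightarrow>\<^bsub>G\<^esub> v)"

definition clique_in :: "('a, 'b) pre_digraph \<Rightarrow> 'a set \<Rightarrow> bool" where
  "clique_in G S \<longleftrightarrow> S \<subseteq> verts G \<and> (\<forall>u\<in>S. \<forall>v\<in>S. u \<noteq> v \<longrightarrow> u \<rightarrow>\<^bsub>G\<^esub> v)"

definition delete_verts :: "('a, 'b) pre_digraph \<Rightarrow> 'a set \<Rightarrow> ('a, 'b) pre_digraph" where
  "delete_verts G X = G \<restriction> (verts G - X)"

definition interval_graph :: "('a, 'b) pre_digraph \<Rightarrow> bool" where
  "interval_graph G \<longleftrightarrow> graph G \<and>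
     (\<exists>l r :: 'a \<Rightarrow> real.
        (\<forall>v\<in>verts G. l v \<le> r v) \<and>
        (\<forall>u\<in>verts G. \<forall>v\<in>verts G. u \<noteq> v \<longrightarrow>
           (u \<rightarrow>\<^bsub>G\<^esub> v \<longleftrightarrow> {l u..r u} \<inter> {l v..r v} \<noteq> {})))"


section \<open>Random access machines\<close>

text \<open>
  A random access machine with registers indexed by and containing natural numbers, a read-only
  input consisting of bits, and addition and (truncated) subtraction as its only arithmetic.
  \<open>Load\<close>, \<open>Store\<close> and \<open>Read\<close> address indirectly. Time and space are measured
  under the logarithmic cost criterion, so that both are polynomially related to those of
  Turing machines: one step of cost \<open>c\<close> in space \<open>s\<close> takes a Turing machine time polynomial
  in \<open>c\<close>, \<open>s\<close> and the length of the input.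
\<close>

datatype instr =
    Const nat nat
  | Add nat nat nat
  | Sub nat nat nat
  | Load nat nat
  | Store nat nat
  | Read nat nat
  | Jz nat nat

type_synonym config = "nat \<times> (nat \<Rightarrow> nat)"

text \<open>Reading beyond the end of the input yields the end marker 2.\<close>

definition input_symbol :: "bool list \<Rightarrow> nat \<Rightarrow> nat" where
  "input_symbol w i = (if i < length w then of_bool (w ! i) else 2)"

fun exec_instr :: "bool list \<Rightarrow> instr \<Rightarrow> config \<Rightarrow> config" where
  "exec_instr w (Const d c) (pc, R) = (Suc pc, R(d := c))"
| "exec_instr w (Add d a b) (pc, R) = (Suc pc, R(d := R a + R b))"
| "exec_instr w (Sub d a b) (pc, R) = (Suc pc, R(d := R a - R b))"
| "exec_instr w (Load d a) (pc, R) = (Suc pc, R(d := R (R a)))"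
| "exec_instr w (Store d a) (pc, R) = (Suc pc, R(R d := R a))"
| "exec_instr w (Read d a) (pc, R) = (Suc pc, R(d := input_symbol w (R a)))"
| "exec_instr w (Jz a t) (pc, R) = ((if R a = 0 then t else Suc pc), R)"

text \<open>The length of the binary representation, where 0 has length 1.\<close>

definition bit_length :: "nat \<Rightarrow> nat" where
  "bit_length m = Suc (floor_log m)"

fun instr_cost :: "instr \<Rightarrow> (nat \<Rightarrow> nat) \<Rightarrow> nat" where
  "instr_cost (Const d c) R = bit_length d + bit_length c"
| "instr_cost (Add d a b) R =
     bit_length d + bit_length a + bit_length b + bit_length (R a) + bit_length (R b)"
| "instr_cost (Sub d a b) R =
     bit_length d + bit_length a + bit_length b + bit_length (R a) + bit_length (R b)"
| "instr_cost (Load d a) R =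
     bit_length d + bit_length a + bit_length (R a) + bit_length (R (R a))"
| "instr_cost (Store d a) R =
     bit_length d + bit_length a + bit_length (R d) + bit_length (R a)"
| "instr_cost (Read d a) R = bit_length d + bit_length a + bit_length (R a)"
| "instr_cost (Jz a t) R = bit_length a + bit_length (R a)"

definition halted :: "instr list \<Rightarrow> config \<Rightarrow> bool" where
  "halted prog cf \<longleftrightarrow> length prog \<le> fst cf"

definition step :: "instr list \<Rightarrow> bool list \<Rightarrow> config \<Rightarrow> config" where
  "step prog w cf = (if halted prog cf then cf else exec_instr w (prog ! fst cf) cf)"

definition step_cost :: "instr list \<Rightarrow> config \<Rightarrow> nat" where
  "step_cost prog cf = (if halted prog cf then 0 else instr_cost (prog ! fst cf) (snd cf))"

definition config_after :: "instr list \<Rightarrow> bool list \<Rightarrow> nat \<Rightarrow> config" where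
  "config_after prog w i = (step prog w ^^ i) (0, \<lambda>_. 0)"

text \<open>
  Only finitely many registers are nonzero in a reachable configuration, so the sum below is
  never the default value for infinite index sets.
\<close>

definition config_space :: "config \<Rightarrow> nat" where
  "config_space cf = (\<Sum>a | snd cf a \<noteq> 0. bit_length a + bit_length (snd cf a))"

text \<open>
  On input \<open>w\<close> the program halts with answer \<open>ans\<close> in register 0, in time at most \<open>T\<close>
  and space at most \<open>S\<close>.
\<close>

definition decides_within ::
  "instr list \<Rightarrow> bool list \<Rightarrow> bool \<Rightarrow> nat \<Rightarrow> nat \<Rightarrow> bool" where
  "decides_within prog w ans T S \<longleftrightarrow>
     (\<exists>m. halted prog (config_after prog w m) \<and>
          snd (config_after prog w m) 0 = of_bool ans \<and>
          (\<Sum>i<m. step_cost prog (config_after prog w i)) \<le> T \<and>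
          (\<forall>i\<le>m. config_space (config_after prog w i) \<le> S))"

definition poly_bounded :: "(nat \<Rightarrow> nat) \<Rightarrow> bool" where
  "poly_bounded t \<longleftrightarrow> (\<exists>d::nat. (\<lambda>n. real (t n)) \<in> O(\<lambda>n. real n ^ d))"


section \<open>Encoding of instances\<close>

text \<open>
  The vertices are numbered in increasing order. The input consists of the number of vertices
  in unary followed by a 0, the rows of the adjacency matrix, the characteristic vector of
  \<open>X\<close>, and the binary digits of \<open>p\<close>, least significant first and without leading zeros.
\<close>

definition encode_instance :: "nat pair_pre_digraph \<Rightarrow> nat set \<Rightarrow> nat \<Rightarrow> bool list" where
  "encode_instance G X p =
     (let vs = sorted_list_of_set (pverts G) in
        replicate (length vs) True @ [False] @
        concat (map (\<lambda>u. map (\<lambda>v. (u, v) \<in> parcs G) vs) vs) @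
        map (\<lambda>v. v \<in> X) vs @
        map (bit p) [0..<bit_length p])"

end

theory Submission
  imports Defs
begin

text \<open>
  Branch over the subsets Y of X. If Y is pairwise compatible (independent, or a clique), the
  best extension of Y lies among the vertices outside X that are compatible with Y, and these
  induce an interval graph. There a vertex v with the leftmost right endpoint is simplicial, that
  is, its neighbourhood is a clique. Hence some maximum independent set contains v and avoids its
  neighbours, while a maximum clique is either the closed neighbourhood of v or avoids v.
  Eliminating simplicial vertices one by one, which needs no interval representation, therefore
  settles each of the at most \<open>2 ^ k\<close> branches in polynomial time. The subsets are enumerated
  by a binary counter, so polynomial space suffices.
\<close>


section \<open>Largest compatible sets\<close>

definition max_pairwise :: "('a \<Rightarrow> 'a \<Rightarrow> bool) \<Rightarrow> 'a set \<Rightarrow> nat" where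
  "max_pairwise P A = Max (card ` {S. S \<subseteq> A \<and> pairwise P S})"

lemma card_le_max_pairwise:
  assumes "finite A" "S \<subseteq> A" "pairwise P S"
  shows "card S \<le> max_pairwise P A"
  unfolding max_pairwise_def using assms by (intro Max_ge) auto

lemma max_pairwise_attained:
  assumes "finite A"
  obtains S where "S \<subseteq> A" "pairwise P S" "card S = max_pairwise P A"
proof -
  have "max_pairwise P A \<in> card ` {S. S \<subseteq> A \<and> pairwise P S}"
    unfolding max_pairwise_def using assms pairwise_empty[of P]
    by (intro Max_in) (auto simp del: pairwise_empty)
  then show thesis using that by auto
qed

lemma max_pairwise_le:
  assumes "finite A" and "\<And>S. S \<subseteq> A \<Longrightarrow> pairwise P S \<Longrightarrow> card S \<le> m"
  shows "max_pairwise P A \<le> m"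
proof -
  obtain S where "S \<subseteq> A" "pairwise P S" "card S = max_pairwise P A"
    using assms(1) by (rule max_pairwise_attained)
  then show ?thesis using assms(2)[of S] by simp
qed

lemma max_pairwise_empty [simp]: "max_pairwise P {} = 0"
  using max_pairwise_le[of "{}" P 0] by simp

lemma max_pairwise_le_card: "finite A \<Longrightarrow> max_pairwise P A \<le> card A"
  by (rule max_pairwise_le) (auto intro: card_mono)

lemma max_pairwise_mono: "finite B \<Longrightarrow> A \<subseteq> B \<Longrightarrow> max_pairwise P A \<le> max_pairwise P B"
  by (intro max_pairwise_le card_le_max_pairwise) (auto intro: finite_subset)

lemma ex_pairwise_card_iff:
  assumes "finite A"
  shows "(\<exists>S\<subseteq>A. pairwise P S \<and> card S = p) \<longleftrightarrow> p \<le> max_pairwise P A"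
proof
  assume "p \<le> max_pairwise P A"
  moreover obtain S where S: "S \<subseteq> A" "pairwise P S" "card S = max_pairwise P A"
    using assms by (rule max_pairwise_attained)
  ultimately obtain T where "T \<subseteq> S" "card T = p" by (metis obtain_subset_with_card_n)
  with S have "T \<subseteq> A" "pairwise P T" by (auto intro: pairwise_subset)
  with \<open>card T = p\<close> show "\<exists>S\<subseteq>A. pairwise P S \<and> card S = p" by blast
qed (use card_le_max_pairwise[OF assms] in blast)

lemma ex_pairwise_card_bij_betw:
  assumes "bij_betw f A B"
  shows "(\<exists>S\<subseteq>B. pairwise P S \<and> card S = p) \<longleftrightarrow>
    (\<exists>S\<subseteq>A. pairwise (\<lambda>i j. P (f i) (f j)) S \<and> card S = p)"
proof -
  have B: "B = f ` A" and inj: "inj_on f A" using assms by (auto simp: bij_betw_def)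
  have "pairwise P (f ` S) \<longleftrightarrow> pairwise (\<lambda>i j. P (f i) (f j)) S" "card (f ` S) = card S"
    if "S \<subseteq> A" for S
    using inj_on_subset[OF inj that] by (auto simp: pairwise_def inj_on_eq_iff card_image)
  then show ?thesis unfolding B subset_image_iff by (metis (no_types, lifting))
qed


section \<open>Simplicial elimination\<close>

datatype problem = Independent_Set | Clique

primrec solution_rel :: "problem \<Rightarrow> ('a \<Rightarrow> 'a \<Rightarrow> bool) \<Rightarrow> 'a \<Rightarrow> 'a \<Rightarrow> bool" where
  "solution_rel Independent_Set E = (\<lambda>u v. \<not> E u v)"
| "solution_rel Clique E = E"

lemma symp_solution_rel: "symp E \<Longrightarrow> symp (solution_rel pr E)"
  by (cases pr) (auto simp: symp_def)

definition closed_nbhd :: "('a \<Rightarrow> 'a \<Rightarrow> bool) \<Rightarrow> 'a set \<Rightarrow> 'a \<Rightarrow> 'a set" where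
  "closed_nbhd E A v = {u \<in> A. u = v \<or> E v u}"

definition simplicial :: "('a \<Rightarrow> 'a \<Rightarrow> bool) \<Rightarrow> 'a set \<Rightarrow> 'a \<Rightarrow> bool" where
  "simplicial E A v \<longleftrightarrow> v \<in> A \<and> pairwise E (closed_nbhd E A v)"

lemma closed_nbhd_subset: "closed_nbhd E A v \<subseteq> A"
  by (auto simp: closed_nbhd_def)

text \<open>
  An independent set meets the closed neighbourhood of a simplicial vertex v in at most one
  vertex, which may be exchanged for v.
\<close>

lemma max_pairwise_simplicial_independent:
  assumes fin: "finite A" and sym: "symp E" and v: "simplicial E A v"
  shows "max_pairwise (\<lambda>u v. \<not> E u v) A =
    Suc (max_pairwise (\<lambda>u v. \<not> E u v) (A - closed_nbhd E A v))"
    (is "?max A = Suc (?max (A - ?N))")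
proof (rule antisym)
  show "?max A \<le> Suc (?max (A - ?N))"
  proof (rule max_pairwise_le[OF fin])
    fix S assume S: "S \<subseteq> A" "pairwise (\<lambda>u v. \<not> E u v) S"
    then have finS: "finite S" using fin by (auto intro: finite_subset)
    have "a = b" if "a \<in> S \<inter> ?N" "b \<in> S \<inter> ?N" for a b
      using that S(2) v unfolding pairwise_def simplicial_def by blast
    then have "card (S \<inter> ?N) \<le> 1" using finS by (simp add: card_le_Suc0_iff_eq)
    moreover have "card (S - ?N) \<le> ?max (A - ?N)"
      using fin S by (intro card_le_max_pairwise) (auto simp: pairwise_def)
    ultimately show "card S \<le> Suc (?max (A - ?N))"
      using card_Int_Diff[OF finS, of ?N] by simp
  qed
  obtain S where S: "S \<subseteq> A - ?N" "pairwise (\<lambda>u v. \<not> E u v) S" "card S = ?max (A - ?N)"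
    using max_pairwise_attained[of "A - ?N"] fin by blast
  have "v \<in> A" "v \<in> ?N" using v by (auto simp: simplicial_def closed_nbhd_def)
  moreover have "\<not> E v u \<and> \<not> E u v" if "u \<in> S" for u
    using that S(1) sym by (auto simp: closed_nbhd_def dest: sympD)
  ultimately have "card (insert v S) \<le> ?max A"
    using fin S by (intro card_le_max_pairwise) (auto simp: pairwise_insert)
  moreover have "finite S" "v \<notin> S" using S fin \<open>v \<in> ?N\<close> by (auto intro: finite_subset)
  ultimately show "Suc (?max (A - ?N)) \<le> ?max A" using S(3) by simp
qed

lemma max_pairwise_simplicial_clique:
  assumes fin: "finite A" and v: "simplicial E A v"
  shows "max_pairwise E A = max (card (closed_nbhd E A v)) (max_pairwise E (A - {v}))"
    (is "_ = max (card ?N) ?rest")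
proof (rule antisym)
  show "max_pairwise E A \<le> max (card ?N) ?rest"
  proof (rule max_pairwise_le[OF fin])
    fix S assume S: "S \<subseteq> A" "pairwise E S"
    show "card S \<le> max (card ?N) ?rest"
    proof (cases "v \<in> S")
      case True
      then have "S \<subseteq> ?N" using S by (auto simp: closed_nbhd_def pairwise_def)
      then have "card S \<le> card ?N" by (rule card_mono[rotated]) (simp add: closed_nbhd_def fin)
      then show ?thesis by simp
    next
      case False
      then have "card S \<le> ?rest" using S fin by (intro card_le_max_pairwise) auto
      then show ?thesis by simp
    qed
  qed
  have "card ?N \<le> max_pairwise E A"
    using v by (intro card_le_max_pairwise fin closed_nbhd_subset) (simp add: simplicial_def)
  moreover have "?rest \<le> max_pairwise E A" using fin by (intro max_pairwise_mono) auto
  ultimately show "max (card ?N) ?rest \<le> max_pairwise E A" by simp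
qed

text \<open>
  A triple (b, c, A) records the best size b found so far and a partial solution of size c that
  may be extended within A.
\<close>

fun attainable :: "('a \<Rightarrow> 'a \<Rightarrow> bool) \<Rightarrow> nat \<times> nat \<times> 'a set \<Rightarrow> nat" where
  "attainable P (b, c, A) = max b (c + max_pairwise P A)"

fun eliminate_vertex ::
  "problem \<Rightarrow> ('a \<Rightarrow> 'a \<Rightarrow> bool) \<Rightarrow> 'a \<Rightarrow> nat \<times> nat \<times> 'a set \<Rightarrow> nat \<times> nat \<times> 'a set" where
  "eliminate_vertex Independent_Set E v (b, c, A) = (b, Suc c, A - closed_nbhd E A v)"
| "eliminate_vertex Clique E v (b, c, A) = (max b (c + card (closed_nbhd E A v)), c, A - {v})"

lemma attainable_eliminate_vertex:
  assumes "finite A" "symp E" "simplicial E A v"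
  shows "attainable (solution_rel pr E) (eliminate_vertex pr E v (b, c, A)) =
    attainable (solution_rel pr E) (b, c, A)"
  using max_pairwise_simplicial_independent[OF assms]
    max_pairwise_simplicial_clique[OF assms(1,3)]
  by (cases pr) (simp_all add: nat_add_max_right max.assoc)

lemma eliminate_vertex_psubset:
  assumes "simplicial E A v"
  shows "snd (snd (eliminate_vertex pr E v (b, c, A))) \<subset> A"
proof -
  have "v \<in> A" "v \<in> closed_nbhd E A v"
    using assms by (auto simp: simplicial_def closed_nbhd_def)
  then show ?thesis by (cases pr) auto
qed

definition hereditarily_simplicial :: "('a \<Rightarrow> 'a \<Rightarrow> bool) \<Rightarrow> 'a set \<Rightarrow> bool" where
  "hereditarily_simplicial E A \<longleftrightarrow> (\<forall>B\<subseteq>A. B \<noteq> {} \<longrightarrow> (\<exists>v. simplicial E B v))"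

definition interval_representation ::
  "('a \<Rightarrow> 'a \<Rightarrow> bool) \<Rightarrow> 'a set \<Rightarrow> ('a \<Rightarrow> 'b::linorder) \<Rightarrow> ('a \<Rightarrow> 'b) \<Rightarrow> bool" where
  "interval_representation E A l r \<longleftrightarrow> (\<forall>v\<in>A. l v \<le> r v) \<and>
     (\<forall>u\<in>A. \<forall>v\<in>A. u \<noteq> v \<longrightarrow> (E u v \<longleftrightarrow> {l u..r u} \<inter> {l v..r v} \<noteq> {}))"

lemma interval_representation_subset:
  "interval_representation E A l r \<Longrightarrow> B \<subseteq> A \<Longrightarrow> interval_representation E B l r"
  by (auto simp: interval_representation_def subset_iff)

lemma interval_representation_comp:
  assumes "interval_representation E (f ` A) l r" "inj_on f A"
  shows "interval_representation (\<lambda>i j. E (f i) (f j)) A (l \<circ> f) (r \<circ> f)"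
  using assms by (simp add: interval_representation_def inj_on_eq_iff del: Int_atLeastAtMost)

lemma interval_representation_simplicial:
  assumes rep: "interval_representation E A l r" and A: "finite A" "A \<noteq> {}"
  obtains v where "simplicial E A v"
proof -
  obtain v where v: "v \<in> A" and leftmost: "\<And>u. u \<in> A \<Longrightarrow> r v \<le> r u"
    using arg_min_if_finite[OF A, of r] by (metis linorder_not_less)
  have "r v \<in> {l u..r u}" if "u \<in> closed_nbhd E A v" for u
  proof -
    have "u = v \<or> {l v..r v} \<inter> {l u..r u} \<noteq> {}"
      using that v rep by (auto simp: closed_nbhd_def interval_representation_def)
    then show ?thesis
      using that v rep leftmost[of u] by (auto simp: closed_nbhd_def interval_representation_def)
  qed
  then have "pairwise E (closed_nbhd E A v)"
    using rep unfolding pairwise_def interval_representation_def closed_nbhd_def by blast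
  then show thesis using that v by (simp add: simplicial_def)
qed

lemma interval_representation_hereditarily_simplicial:
  assumes "interval_representation E A l r" "finite A"
  shows "hereditarily_simplicial E A"
  unfolding hereditarily_simplicial_def
proof (intro allI impI)
  fix B assume B: "B \<subseteq> A" "B \<noteq> {}"
  then have "interval_representation E B l r" "finite B"
    using assms interval_representation_subset finite_subset by blast+
  then show "\<exists>v. simplicial E B v" using B(2) by (rule interval_representation_simplicial) blast
qed


section \<open>Branching on the modulator\<close>

definition extenders :: "('a \<Rightarrow> 'a \<Rightarrow> bool) \<Rightarrow> 'a set \<Rightarrow> 'a set \<Rightarrow> 'a set" where
  "extenders P B Y = {u \<in> B. \<forall>v\<in>Y. P u v}"

definition branch_value :: "('a \<Rightarrow> 'a \<Rightarrow> bool) \<Rightarrow> 'a set \<Rightarrow> 'a set \<Rightarrow> nat" where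
  "branch_value P B Y =
     (if pairwise P Y then card Y + max_pairwise P (extenders P B Y) else 0)"

definition best_branch :: "('a \<Rightarrow> 'a \<Rightarrow> bool) \<Rightarrow> 'a set \<Rightarrow> 'a set set \<Rightarrow> nat" where
  "best_branch P B \<Y> = Max (insert 0 (branch_value P B ` \<Y>))"

lemma best_branch_empty [simp]: "best_branch P B {} = 0"
  by (simp add: best_branch_def)

lemma best_branch_insert:
  "finite \<Y> \<Longrightarrow> best_branch P B (insert Y \<Y>) = max (best_branch P B \<Y>) (branch_value P B Y)"
  by (simp add: best_branch_def insert_commute[of 0] max.commute)

lemma best_branch_le_iff:
  "finite \<Y> \<Longrightarrow> best_branch P B \<Y> \<le> m \<longleftrightarrow> (\<forall>Y\<in>\<Y>. branch_value P B Y \<le> m)"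
  by (auto simp: best_branch_def)

lemma branch_value_le_max_pairwise:
  assumes fin: "finite V" and X: "X \<subseteq> V" and sym: "symp P" and Y: "Y \<subseteq> X"
  shows "branch_value P (V - X) Y \<le> max_pairwise P V"
proof (cases "pairwise P Y")
  case True
  let ?ext = "extenders P (V - X) Y"
  have "finite ?ext" using fin by (simp add: extenders_def)
  then obtain S where S: "S \<subseteq> ?ext" "pairwise P S" "card S = max_pairwise P ?ext"
    by (rule max_pairwise_attained)
  have disjoint: "Y \<inter> S = {}" and sub: "Y \<union> S \<subseteq> V" using S(1) X Y by (auto simp: extenders_def)
  have "P u v \<and> P v u" if "u \<in> S" "v \<in> Y" for u v
    using that S(1) sym by (auto simp: extenders_def dest: sympD)
  then have "pairwise P (Y \<union> S)" using S(2) True by (auto simp: pairwise_def)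
  then have "card (Y \<union> S) \<le> max_pairwise P V" using fin sub by (intro card_le_max_pairwise)
  moreover have "card (Y \<union> S) = card Y + card S"
    using disjoint sub fin by (intro card_Un_disjoint) (auto intro: finite_subset)
  ultimately show ?thesis using S(3) True by (simp add: branch_value_def)
qed (simp add: branch_value_def)

lemma best_branch_le_max_pairwise:
  assumes "finite V" "X \<subseteq> V" "symp P" "\<Y> \<subseteq> Pow X"
  shows "best_branch P (V - X) \<Y> \<le> max_pairwise P V"
proof -
  have "finite \<Y>" using assms by (meson finite_Pow_iff finite_subset)
  then show ?thesis
    using assms branch_value_le_max_pairwise[OF assms(1-3)] by (auto simp: best_branch_le_iff)
qed

lemma best_branch_Pow:
  assumes fin: "finite V" and X: "X \<subseteq> V" and sym: "symp P"
  shows "best_branch P (V - X) (Pow X) = max_pairwise P V"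
proof (rule antisym)
  obtain S where S: "S \<subseteq> V" "pairwise P S" "card S = max_pairwise P V"
    using fin by (rule max_pairwise_attained)
  have "S - X \<subseteq> extenders P (V - X) (S \<inter> X)"
    using S by (auto simp: extenders_def pairwise_def)
  moreover have "finite (extenders P (V - X) (S \<inter> X))" using fin by (simp add: extenders_def)
  ultimately have "card (S - X) \<le> max_pairwise P (extenders P (V - X) (S \<inter> X))"
    using S(2) by (intro card_le_max_pairwise) (auto intro: pairwise_subset)
  moreover have "card S = card (S \<inter> X) + card (S - X)"
    by (rule card_Int_Diff[OF finite_subset[OF S(1) fin]])
  moreover have "pairwise P (S \<inter> X)" using S(2) by (rule pairwise_subset) simp
  ultimately have "max_pairwise P V \<le> branch_value P (V - X) (S \<inter> X)"
    using S(3) by (simp add: branch_value_def)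
  also have "\<dots> \<le> best_branch P (V - X) (Pow X)"
    using finite_subset[OF X fin] by (auto simp: best_branch_def intro: Max_ge)
  finally show "max_pairwise P V \<le> best_branch P (V - X) (Pow X)" .
qed (rule best_branch_le_max_pairwise[OF assms order_refl])


section \<open>Enumerating subsets by a binary counter\<close>

definition colex_less :: "'a::linorder set \<Rightarrow> 'a set \<Rightarrow> bool" where
  "colex_less Y Z \<longleftrightarrow> (\<exists>m. m \<in> Z \<and> m \<notin> Y \<and> (\<forall>x>m. x \<in> Y \<longleftrightarrow> x \<in> Z))"

text \<open>Incrementing a binary counter flips a bit if and only if all lower bits are set.\<close>

definition colex_succ :: "'a::linorder set \<Rightarrow> 'a set \<Rightarrow> 'a set" where
  "colex_succ X Y = {x \<in> X. x \<notin> Y \<longleftrightarrow> (\<forall>y\<in>X. y < x \<longrightarrow> y \<in> Y)}"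

definition colex_below :: "'a::linorder set \<Rightarrow> 'a set \<Rightarrow> 'a set set" where
  "colex_below X Y = {Z. Z \<subseteq> X \<and> colex_less Z Y}"

definition nth_subset :: "'a::linorder set \<Rightarrow> nat \<Rightarrow> 'a set" where
  "nth_subset X j = (colex_succ X ^^ j) {}"

lemma colex_less_trans:
  assumes "colex_less W Y" "colex_less Y Z"
  shows "colex_less W Z"
proof -
  obtain m where m: "m \<in> Y" "m \<notin> W" "\<And>x. x > m \<Longrightarrow> x \<in> W \<longleftrightarrow> x \<in> Y"
    using assms(1) by (auto simp: colex_less_def)
  obtain k where k: "k \<in> Z" "k \<notin> Y" "\<And>x. x > k \<Longrightarrow> x \<in> Y \<longleftrightarrow> x \<in> Z"
    using assms(2) by (auto simp: colex_less_def)
  have "m \<noteq> k" using m k by blast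
  then show ?thesis
    unfolding colex_less_def using m k by (intro exI[of _ "max m k"]) (auto simp: max_def)
qed

lemma not_colex_less_superset: "Y \<subseteq> Z \<Longrightarrow> \<not> colex_less Z Y"
  by (auto simp: colex_less_def)

lemma colex_less_psubset:
  assumes "finite Y" "Z \<subset> Y"
  shows "colex_less Z Y"
proof -
  have top: "Max (Y - Z) \<in> Y - Z" using assms by (intro Max_in) auto
  have "x \<in> Z \<longleftrightarrow> x \<in> Y" if "x > Max (Y - Z)" for x
    using that assms Max_ge[of "Y - Z" x] by fastforce
  then show ?thesis unfolding colex_less_def using top by blast
qed

lemma colex_below_empty [simp]: "colex_below X {} = {}"
  by (simp add: colex_below_def colex_less_def)

lemma finite_colex_below: "finite X \<Longrightarrow> finite (colex_below X Y)"
  by (simp add: colex_below_def)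

lemma notin_colex_below: "Y \<notin> colex_below X Y"
  by (simp add: colex_below_def not_colex_less_superset)

lemma card_insert_colex_below:
  "finite X \<Longrightarrow> card (insert Y (colex_below X Y)) = Suc (card (colex_below X Y))"
  by (simp add: finite_colex_below notin_colex_below)

lemma insert_colex_below_self: "finite X \<Longrightarrow> insert X (colex_below X X) = Pow X"
  by (auto simp: colex_below_def intro: colex_less_psubset)

lemma colex_succ_subset: "colex_succ X Y \<subseteq> X"
  by (auto simp: colex_succ_def)

lemma colex_succ_eq:
  assumes "Y \<subseteq> X" "m \<in> X - Y" "\<And>x. x \<in> X \<Longrightarrow> x < m \<Longrightarrow> x \<in> Y"
  shows "colex_succ X Y = insert m {x \<in> Y. m < x}"
proof (intro set_eqI)
  fix x
  show "x \<in> colex_succ X Y \<longleftrightarrow> x \<in> insert m {x \<in> Y. m < x}"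
    using assms by (cases x m rule: linorder_cases) (auto simp: colex_succ_def)
qed

lemma colex_below_succ:
  assumes fin: "finite X" and Y: "Y \<subset> X"
  shows "colex_below X (colex_succ X Y) = insert Y (colex_below X Y)"
proof -
  define m where "m = Min (X - Y)"
  have m: "m \<in> X - Y" unfolding m_def using fin Y by (intro Min_in) auto
  have below: "x \<in> Y" if "x \<in> X" "x < m" for x
    using that Min_le[of "X - Y" x] fin unfolding m_def by fastforce
  have succ: "colex_succ X Y = insert m {x \<in> Y. m < x}"
    using Y m below by (intro colex_succ_eq) auto
  have up: "colex_less Y (colex_succ X Y)"
    unfolding succ colex_less_def using m by (intro exI[of _ m]) auto
  have "Z = Y \<or> colex_less Z Y" if Z: "Z \<subseteq> X" "colex_less Z (colex_succ X Y)" for Z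
  proof -
    obtain k where k: "k \<in> insert m {x \<in> Y. m < x}" "k \<notin> Z"
      and above: "\<And>x. x > k \<Longrightarrow> x \<in> Z \<longleftrightarrow> x \<in> insert m {x \<in> Y. m < x}"
      using Z(2) unfolding succ colex_less_def by blast
    show ?thesis
    proof (cases "k = m")
      case True
      have "x \<in> Y" if "x \<in> Z" for x
        using that True k above below Z(1) by (cases x m rule: linorder_cases) auto
      then show ?thesis
        using colex_less_psubset[of Y Z] finite_subset[of Y X] fin Y by blast
    next
      case False
      then show ?thesis
        unfolding colex_less_def using k above by (intro disjI2 exI[of _ k]) auto
    qed
  qed
  then show ?thesis using up Y by (auto simp: colex_below_def intro: colex_less_trans)
qed

lemma nth_subset_0 [simp]: "nth_subset X 0 = {}"
  by (simp add: nth_subset_def)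

lemma nth_subset_Suc: "nth_subset X (Suc j) = colex_succ X (nth_subset X j)"
  by (simp add: nth_subset_def)

lemma nth_subset_subset: "nth_subset X j \<subseteq> X"
  by (cases j) (simp_all add: nth_subset_Suc colex_succ_subset)

lemma colex_below_nth_subset:
  assumes "finite X" "j < 2 ^ card X"
  shows "colex_below X (nth_subset X j) = nth_subset X ` {..<j}"
    and "card (colex_below X (nth_subset X j)) = j"
proof -
  have "colex_below X (nth_subset X j) = nth_subset X ` {..<j} \<and>
    card (colex_below X (nth_subset X j)) = j"
    using assms(2)
  proof (induction j)
    case (Suc j)
    let ?Y = "nth_subset X j"
    have IH: "colex_below X ?Y = nth_subset X ` {..<j}" "card (colex_below X ?Y) = j"
      using Suc.IH Suc.prems by auto
    have card: "card (insert ?Y (colex_below X ?Y)) = Suc j"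
      using IH(2) card_insert_colex_below[OF assms(1)] by simp
    then have "?Y \<noteq> X"
      using Suc.prems insert_colex_below_self[OF assms(1)] assms(1) by (auto simp: card_Pow)
    then have "colex_below X (nth_subset X (Suc j)) = insert ?Y (colex_below X ?Y)"
      unfolding nth_subset_Suc using assms(1) nth_subset_subset[of X j]
      by (intro colex_below_succ) auto
    then show ?case using IH card by (simp add: lessThan_Suc)
  qed simp
  then show "colex_below X (nth_subset X j) = nth_subset X ` {..<j}"
    and "card (colex_below X (nth_subset X j)) = j" by auto
qed

lemma nth_subset_eq_self_iff:
  assumes "finite X" "j < 2 ^ card X"
  shows "nth_subset X j = X \<longleftrightarrow> Suc j = 2 ^ card X"
proof -
  let ?Y = "nth_subset X j"
  have card: "card (insert ?Y (colex_below X ?Y)) = Suc j"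
    using colex_below_nth_subset(2)[OF assms] card_insert_colex_below[OF assms(1)] by simp
  show ?thesis
  proof
    assume "?Y = X"
    then show "Suc j = 2 ^ card X"
      using card insert_colex_below_self[OF assms(1)] assms(1) by (simp add: card_Pow)
  next
    assume "Suc j = 2 ^ card X"
    moreover have "insert ?Y (colex_below X ?Y) \<subseteq> Pow X"
      using nth_subset_subset by (auto simp: colex_below_def)
    ultimately have "insert ?Y (colex_below X ?Y) = Pow X"
      using card assms(1) by (intro card_subset_eq) (simp_all add: card_Pow)
    moreover have "X \<notin> colex_below X ?Y"
      by (simp add: colex_below_def not_colex_less_superset nth_subset_subset)
    ultimately show "?Y = X" by blast
  qed
qed

lemma nth_subset_image:
  assumes "finite X"
  shows "nth_subset X ` {..<2 ^ card X} = Pow X"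
proof -
  obtain j where j: "2 ^ card X = Suc j" using not0_implies_Suc[of "2 ^ card X"] by auto
  then have "nth_subset X j = X" "colex_below X (nth_subset X j) = nth_subset X ` {..<j}"
    using nth_subset_eq_self_iff[OF assms] colex_below_nth_subset(1)[OF assms] by simp_all
  then show ?thesis
    using insert_colex_below_self[OF assms] by (simp add: j lessThan_Suc)
qed


section \<open>A loop language with saturating arithmetic\<close>

text \<open>
  All values are kept at most N by saturating addition, so values, addresses, and the number
  of iterations of every loop are bounded by construction, and the running time of a command
  is bounded independently of the store.
\<close>

datatype var = Answer | Order | Last | Target | Weight | Best | Size | Nbhd_Size | Finished
  | Round | Pivot | Vertex | Bound nat

datatype array = Chosen | Candidates

datatype loc = Var var | Tmp nat | Arr array nat

type_synonym store = "loc \<Rightarrow> nat"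

datatype com =
    Skip
  | Flag loc bool
  | Plus loc loc loc
  | Minus loc loc loc
  | Input nat loc loc
  | Get array loc loc
  | Put array loc loc
  | Seq com com (infixr \<open>;;\<close> 60)
  | Cond loc com com
  | Loop loc loc com

primrec sem :: "bool list \<Rightarrow> nat \<Rightarrow> com \<Rightarrow> store \<Rightarrow> store" where
  "sem w N Skip s = s"
| "sem w N (Flag x b) s = s(x := of_bool b)"
| "sem w N (Plus x y z) s = s(x := min N (s y + s z))"
| "sem w N (Minus x y z) s = s(x := s y - s z)"
| "sem w N (Input b x y) s = s(x := of_bool (input_symbol w (s y) = b))"
| "sem w N (Get a x y) s = s(x := s (Arr a (s y)))"
| "sem w N (Put a x y) s = s(Arr a (s x) := s y)"
| "sem w N (c1 ;; c2) s = sem w N c2 (sem w N c1 s)"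
| "sem w N (Cond x c1 c2) s = (if s x \<noteq> 0 then sem w N c1 s else sem w N c2 s)"
| sem_Loop: "sem w N (Loop x y c) s = fold (\<lambda>i s'. sem w N c (s'(x := i))) [0..<s y] s"

declare sem_Loop [simp del]

lemma sem_le:
  assumes "1 \<le> N" "\<And>l. s l \<le> N"
  shows "sem w N c s l \<le> N"
  using assms(2)
proof (induction c arbitrary: s l)
  case (Minus x y z)
  then show ?case by (auto intro: le_trans[OF diff_le_self])
next
  case (Loop x y c)
  have "\<forall>l. fold (\<lambda>i s'. sem w N c (s'(x := i))) [0..<s y] s l \<le> N"
  proof (rule fold_invariant[where P = "\<lambda>s'. \<forall>l. s' l \<le> N" and Q = "\<lambda>i. i < s y"])
    fix i and s' :: store assume "i < s y" "\<forall>l. s' l \<le> N"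
    then show "\<forall>l. sem w N c (s'(x := i)) l \<le> N"
      using Loop.prems[of y] by (intro allI Loop.IH) auto
  qed (use Loop.prems in auto)
  then show ?case by (simp add: sem_Loop)
qed (use assms(1) in auto)

definition agree_except :: "loc set \<Rightarrow> store \<Rightarrow> store \<Rightarrow> bool" where
  "agree_except L s t \<longleftrightarrow> (\<forall>l. l \<notin> L \<longrightarrow> t l = s l)"

lemma agree_except_refl [simp]: "agree_except L s s"
  by (simp add: agree_except_def)

lemma agree_except_trans:
  "agree_except L s t \<Longrightarrow> agree_except L t u \<Longrightarrow> agree_except L s u"
  by (simp add: agree_except_def)

lemma agree_except_mono: "agree_except L s t \<Longrightarrow> L \<subseteq> L' \<Longrightarrow> agree_except L' s t"
  by (auto simp: agree_except_def)

lemma agree_exceptD: "agree_except L s t \<Longrightarrow> l \<notin> L \<Longrightarrow> t l = s l"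
  by (simp add: agree_except_def)

primrec mods :: "com \<Rightarrow> loc set" where
  "mods Skip = {}"
| "mods (Flag x b) = {x}"
| "mods (Plus x y z) = {x}"
| "mods (Minus x y z) = {x}"
| "mods (Input b x y) = {x}"
| "mods (Get a x y) = {x}"
| "mods (Put a x y) = range (Arr a)"
| "mods (c1 ;; c2) = mods c1 \<union> mods c2"
| "mods (Cond x c1 c2) = mods c1 \<union> mods c2"
| "mods (Loop x y c) = insert x (mods c)"

lemma agree_except_mods: "agree_except (mods c) s (sem w N c s)"
proof (induction c arbitrary: s)
  case (Seq c1 c2)
  then show ?case
    by (auto intro: agree_except_trans[where t = "sem w N c1 s"] agree_except_mono)
next
  case (Loop x y c)
  show ?case
    unfolding sem_Loop
  proof (rule fold_invariant[where P = "agree_except (mods (Loop x y c)) s" and Q = "\<lambda>_. True"])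
    fix i :: nat and s' assume "agree_except (mods (Loop x y c)) s s'"
    moreover have "agree_except (mods c) (s'(x := i)) (sem w N c (s'(x := i)))" by (rule Loop.IH)
    ultimately show "agree_except (mods (Loop x y c)) s (sem w N c (s'(x := i)))"
      by (simp add: agree_except_def)
  qed simp_all
qed (auto simp: agree_except_def)

lemma sem_frame: "l \<notin> mods c \<Longrightarrow> sem w N c s l = s l"
  using agree_except_mods by (rule agree_exceptD)

lemma sem_Loop_invariant:
  assumes "I 0 s"
    and "\<And>i t. i < s y \<Longrightarrow> I i t \<Longrightarrow> agree_except (insert x (mods c)) s t \<Longrightarrow>
      I (Suc i) (sem w N c (t(x := i)))"
  shows "I (s y) (sem w N (Loop x y c) s)"
proof -
  let ?iterate = "\<lambda>m. fold (\<lambda>i s'. sem w N c (s'(x := i))) [0..<m] s"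
  have "I m (?iterate m) \<and> agree_except (insert x (mods c)) s (?iterate m)" if "m \<le> s y" for m
    using that
  proof (induction m)
    case (Suc m)
    define t where "t = ?iterate m"
    have t: "I m t" "agree_except (insert x (mods c)) s t"
      using Suc.IH[OF Suc_leD[OF Suc.prems]] unfolding t_def by blast+
    then have "I (Suc m) (sem w N c (t(x := m)))" using Suc.prems assms(2) by simp
    moreover have "agree_except (insert x (mods c)) s (sem w N c (t(x := m)))"
      using t(2) agree_except_mods[of c "t(x := m)" w N] by (simp add: agree_except_def)
    ultimately show ?case by (simp add: t_def del: fun_upd_apply)
  qed (simp add: assms(1))
  then show ?thesis by (simp add: sem_Loop)
qed

primrec time :: "nat \<Rightarrow> com \<Rightarrow> nat" where
  "time N Skip = 0"
| "time N (Flag x b) = 1"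
| "time N (Plus x y z) = 3"
| "time N (Minus x y z) = 1"
| "time N (Input b x y) = 7"
| "time N (Get a x y) = 5"
| "time N (Put a x y) = 5"
| "time N (c1 ;; c2) = time N c1 + time N c2"
| "time N (Cond x c1 c2) = time N c1 + time N c2 + 2"
| "time N (Loop x y c) = N * (time N c + 6) + 4"


section \<open>Compilation to random access machines\<close>

text \<open>
  \<open>Cap\<close> and \<open>Zero\<close> permanently hold N and 0; \<open>Counter\<close> and \<open>Limit\<close> are indexed by the
  nesting depth of loops. Residues of addresses tell the kinds of registers apart.
\<close>

datatype reg = Loc loc | Cap | Zero | Acc | Aux | Counter nat | Limit nat

primrec var_index :: "var \<Rightarrow> nat" where
  "var_index Answer = 0"
| "var_index Order = 1"
| "var_index Last = 2"
| "var_index Target = 3"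
| "var_index Weight = 4"
| "var_index Best = 5"
| "var_index Size = 6"
| "var_index Nbhd_Size = 7"
| "var_index Finished = 8"
| "var_index Round = 9"
| "var_index Pivot = 10"
| "var_index Vertex = 11"
| "var_index (Bound q) = q + 12"

fun addr :: "reg \<Rightarrow> nat" where
  "addr (Loc (Var x)) = 8 * var_index x"
| "addr (Loc (Tmp j)) = 8 * j + 4"
| "addr (Loc (Arr Chosen i)) = 4 * i + 2"
| "addr (Loc (Arr Candidates i)) = 4 * i + 3"
| "addr Cap = 1"
| "addr Zero = 5"
| "addr Acc = 9"
| "addr Aux = 13"
| "addr (Counter d) = 8 * d + 17"
| "addr (Limit d) = 8 * d + 21"

abbreviation loc_addr :: "loc \<Rightarrow> nat" where
  "loc_addr x \<equiv> addr (Loc x)"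

lemma var_index_eq_iff [simp]: "var_index x = var_index y \<longleftrightarrow> x = y"
  by (cases x; cases y) simp_all

lemma addr_eq_iff [simp]: "addr r = addr r' \<longleftrightarrow> r = r'"
  by (cases r rule: addr.cases; cases r' rule: addr.cases; simp; presburger?)

lemma loc_addr_Arr: "loc_addr (Arr a i) = 4 * i + loc_addr (Arr a 0)"
  by (cases a) simp_all

lemma loc_addr_Arr_le: "loc_addr (Arr a i) \<le> 4 * i + 3"
  by (cases a) simp_all

lemma loc_addr_Answer: "loc_addr (Var Answer) = 0"
  by simp

declare addr.simps [simp del]

text \<open>
  The arguments of \<open>code\<close> are the nesting depth and the address of the first instruction. With
  truncated subtraction, \<open>v - (v - N)\<close> is \<open>min N v\<close>, and \<open>(1 - (b - a)) - (a - b)\<close> is 1 if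
  \<open>a = b\<close> and 0 otherwise.
\<close>

primrec code :: "com \<Rightarrow> nat \<Rightarrow> nat \<Rightarrow> instr list" where
  "code Skip d pc = []"
| "code (Flag x b) d pc = [Const (loc_addr x) (of_bool b)]"
| "code (Plus x y z) d pc =
    [Add (addr Acc) (loc_addr y) (loc_addr z), Sub (addr Aux) (addr Acc) (addr Cap),
     Sub (loc_addr x) (addr Acc) (addr Aux)]"
| "code (Minus x y z) d pc = [Sub (loc_addr x) (loc_addr y) (loc_addr z)]"
| "code (Input b x y) d pc =
    [Read (addr Acc) (loc_addr y), Const (addr Aux) b,
     Sub (loc_addr x) (addr Acc) (addr Aux), Sub (addr Aux) (addr Aux) (addr Acc),
     Const (addr Acc) 1, Sub (addr Acc) (addr Acc) (addr Aux),
     Sub (loc_addr x) (addr Acc) (loc_addr x)]"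
| "code (Get a x y) d pc =
    [Add (addr Acc) (loc_addr y) (loc_addr y), Add (addr Acc) (addr Acc) (addr Acc),
     Const (addr Aux) (loc_addr (Arr a 0)), Add (addr Acc) (addr Acc) (addr Aux),
     Load (loc_addr x) (addr Acc)]"
| "code (Put a x y) d pc =
    [Add (addr Acc) (loc_addr x) (loc_addr x), Add (addr Acc) (addr Acc) (addr Acc),
     Const (addr Aux) (loc_addr (Arr a 0)), Add (addr Acc) (addr Acc) (addr Aux),
     Store (addr Acc) (loc_addr y)]"
| "code (c1 ;; c2) d pc = code c1 d pc @ code c2 d (pc + length (code c1 d pc))"
| "code (Cond x c1 c2) d pc =
    (let k1 = code c1 d (Suc pc); pc2 = pc + 2 + length k1; k2 = code c2 d pc2 in
     [Jz (loc_addr x) pc2] @ k1 @ [Jz (addr Zero) (pc2 + length k2)] @ k2)"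
| "code (Loop x y c) d pc =
    (let k = code c (Suc d) (pc + 5) in
     [Const (addr (Counter d)) 0, Add (addr (Limit d)) (loc_addr y) (addr Zero),
      Sub (addr Acc) (addr (Limit d)) (addr (Counter d)), Jz (addr Acc) (pc + 8 + length k),
      Add (loc_addr x) (addr (Counter d)) (addr Zero)] @ k @
     [Const (addr Acc) 1, Add (addr (Counter d)) (addr (Counter d)) (addr Acc),
      Jz (addr Zero) (pc + 2)])"

fun operand_bound :: "instr \<Rightarrow> nat" where
  "operand_bound (Const d c) = max d c"
| "operand_bound (Add d a b) = max d (max a b)"
| "operand_bound (Sub d a b) = max d (max a b)"
| "operand_bound (Load d a) = max d a"
| "operand_bound (Store d a) = max d a"
| "operand_bound (Read d a) = max d a"
| "operand_bound (Jz a t) = a"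

definition fits :: "nat \<Rightarrow> (nat \<Rightarrow> nat) \<Rightarrow> bool" where
  "fits B R \<longleftrightarrow> (\<forall>a. R a \<le> B \<and> (B < a \<longrightarrow> R a = 0))"

lemma fits_upd: "fits B R \<Longrightarrow> d \<le> B \<Longrightarrow> v \<le> B \<Longrightarrow> fits B (R(d := v))"
  by (auto simp: fits_def)

definition code_at :: "instr list \<Rightarrow> nat \<Rightarrow> instr list \<Rightarrow> bool" where
  "code_at prog pc k \<longleftrightarrow> (\<forall>i<length k. pc + i < length prog \<and> prog ! (pc + i) = k ! i)"

lemma code_at_self: "code_at prog 0 prog"
  by (simp add: code_at_def)

lemma code_at_Nil [simp]: "code_at prog pc []"
  by (simp add: code_at_def)

lemma code_at_Cons [simp]:
  "code_at prog pc (i # k) \<longleftrightarrow> pc < length prog \<and> prog ! pc = i \<and> code_at prog (Suc pc) k"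
  by (auto simp: code_at_def nth_Cons less_Suc_eq_0_disj split: nat.splits)

lemma code_at_append [simp]:
  "code_at prog pc (k @ k') \<longleftrightarrow> code_at prog pc k \<and> code_at prog (pc + length k) k'"
  by (induction k arbitrary: pc) auto

lemma code_at_Cond:
  assumes "code_at prog pc (code (Cond x c1 c2) d pc)"
  defines "k1 \<equiv> code c1 d (Suc pc)"
  defines "pc2 \<equiv> pc + 2 + length k1"
  defines "k2 \<equiv> code c2 d pc2"
  shows "code_at prog pc [Jz (loc_addr x) pc2]"
    and "code_at prog (Suc pc) k1"
    and "code_at prog (Suc pc + length k1) [Jz (addr Zero) (pc2 + length k2)]"
    and "code_at prog pc2 k2"
  using assms(1) by (simp_all add: k1_def pc2_def k2_def Let_def)

lemma code_at_Loop:
  assumes "code_at prog pc (code (Loop x y c) d pc)"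
  defines "k \<equiv> code c (Suc d) (pc + 5)"
  shows "code_at prog pc
      [Const (addr (Counter d)) 0, Add (addr (Limit d)) (loc_addr y) (addr Zero)]"
    and "code_at prog (pc + 2) [Sub (addr Acc) (addr (Limit d)) (addr (Counter d))]"
    and "code_at prog (pc + 3) [Jz (addr Acc) (pc + 8 + length k)]"
    and "code_at prog (pc + 4) [Add (loc_addr x) (addr (Counter d)) (addr Zero)]"
    and "code_at prog (pc + 5) k"
    and "code_at prog (pc + 5 + length k)
      [Const (addr Acc) 1, Add (addr (Counter d)) (addr (Counter d)) (addr Acc)]"
    and "code_at prog (pc + 7 + length k) [Jz (addr Zero) (pc + 2)]"
  using assms(1) by (simp_all add: k_def Let_def eval_nat_numeral)

locale machine =
  fixes prog :: "instr list" and w :: "bool list" and N B :: nat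
  assumes operand_bound_le: "i \<in> set prog \<Longrightarrow> operand_bound i \<le> B"
    and addresses_le: "4 * N + 3 \<le> B" and cap_pos: "1 \<le> N"
begin

definition reaches :: "config \<Rightarrow> nat \<Rightarrow> config \<Rightarrow> bool" where
  "reaches cf T cf' \<longleftrightarrow> (\<exists>m\<le>T. (step prog w ^^ m) cf = cf' \<and>
     (\<forall>i\<le>m. fits B (snd ((step prog w ^^ i) cf))))"

lemma reaches_refl: "fits B (snd cf) \<Longrightarrow> reaches cf 0 cf"
  by (simp add: reaches_def)

lemma reaches_mono: "reaches cf T cf' \<Longrightarrow> T \<le> T' \<Longrightarrow> reaches cf T' cf'"
  unfolding reaches_def using le_trans by blast

lemma reaches_fits: "reaches cf T cf' \<Longrightarrow> fits B (snd cf')"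
  by (auto simp: reaches_def)

lemma reaches_trans:
  assumes "reaches cf T cf'" "reaches cf' T' cf''"
  shows "reaches cf (T + T') cf''"
proof -
  obtain m where m: "m \<le> T" "(step prog w ^^ m) cf = cf'"
    "\<And>i. i \<le> m \<Longrightarrow> fits B (snd ((step prog w ^^ i) cf))"
    using assms(1) by (auto simp: reaches_def)
  obtain m' where m': "m' \<le> T'" "(step prog w ^^ m') cf' = cf''"
    "\<And>i. i \<le> m' \<Longrightarrow> fits B (snd ((step prog w ^^ i) cf'))"
    using assms(2) by (auto simp: reaches_def)
  have continue: "(step prog w ^^ (m + i)) cf = (step prog w ^^ i) cf'" for i
    using m(2) by (simp add: funpow_add add.commute[of m i])
  have "fits B (snd ((step prog w ^^ i) cf))" if "i \<le> m + m'" for i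
  proof (cases "i \<le> m")
    case False
    then show ?thesis using m'(3)[of "i - m"] continue[of "i - m"] that by simp
  qed (use m(3) in simp)
  then show ?thesis
    unfolding reaches_def using m(1) m'(1,2) continue by (intro exI[of _ "m + m'"]) simp
qed

lemma reaches_step:
  assumes "fits B R" "pc < length prog" "exec_instr w (prog ! pc) (pc, R) = (pc', R')"
    and "fits B R'"
  shows "reaches (pc, R) 1 (pc', R')"
  unfolding reaches_def
  using assms by (intro exI[of _ 1]) (auto simp: step_def halted_def le_Suc_eq)

lemma reaches_Jz:
  assumes "code_at prog pc [Jz a t]" "fits B R"
  shows "reaches (pc, R) 1 (if R a = 0 then t else Suc pc, R)"
  using assms by (intro reaches_step) auto

lemma reaches_iterate:
  assumes "I 0 cf" "fits B (snd cf)"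
    and "\<And>j cf. j < M \<Longrightarrow> I j cf \<Longrightarrow> fits B (snd cf) \<Longrightarrow> \<exists>cf'. reaches cf T cf' \<and> I (Suc j) cf'"
  obtains cf' where "reaches cf (M * T) cf'" "I M cf'"
proof -
  have "\<exists>cf'. reaches cf (j * T) cf' \<and> I j cf'" if "j \<le> M" for j
    using that
  proof (induction j)
    case 0
    show ?case using assms(1) reaches_refl[OF assms(2)] by (intro exI[of _ cf]) simp
  next
    case (Suc j)
    then obtain cf1 where "reaches cf (j * T) cf1" "I j cf1" by auto
    moreover obtain cf2 where "reaches cf1 T cf2" "I (Suc j) cf2"
      using assms(3) calculation reaches_fits Suc.prems by (meson Suc_le_lessD)
    ultimately have "reaches cf (j * T + T) cf2" "I (Suc j) cf2" by (auto intro: reaches_trans)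
    then show ?case by (intro exI[of _ cf2]) (simp add: add.commute)
  qed
  then show thesis using that by blast
qed

fun straight_line :: "instr list \<Rightarrow> (nat \<Rightarrow> nat) \<Rightarrow> bool" where
  "straight_line [] R \<longleftrightarrow> True"
| "straight_line (Jz a t # k) R \<longleftrightarrow> False"
| "straight_line (Add d a b # k) R \<longleftrightarrow> R a + R b \<le> B \<and> straight_line k (R(d := R a + R b))"
| "straight_line (i # k) R \<longleftrightarrow> straight_line k (snd (exec_instr w i (0, R)))"

definition exec_line :: "instr list \<Rightarrow> (nat \<Rightarrow> nat) \<Rightarrow> nat \<Rightarrow> nat" where
  "exec_line k R = fold (\<lambda>i R. snd (exec_instr w i (0, R))) k R"

lemma exec_line_simps [simp]:
  "exec_line [] R = R" "exec_line (i # k) R = exec_line k (snd (exec_instr w i (0, R)))"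
  by (simp_all add: exec_line_def)

lemma reaches_line:
  assumes "code_at prog pc k" "fits B R" "straight_line k R"
  shows "reaches (pc, R) (length k) (pc + length k, exec_line k R)"
  using assms
proof (induction k arbitrary: pc R)
  case Nil
  then show ?case by (simp add: reaches_refl)
next
  case (Cons i k)
  let ?R = "snd (exec_instr w i (0, R))"
  have at: "pc < length prog" "prog ! pc = i" "code_at prog (Suc pc) k" using Cons.prems by auto
  then have "operand_bound i \<le> B" using operand_bound_le nth_mem by blast
  moreover have "R a \<le> B" for a using Cons.prems(2) by (simp add: fits_def)
  ultimately have step: "exec_instr w i (pc, R) = (Suc pc, ?R)" "fits B ?R" "straight_line k ?R"
    using Cons.prems addresses_le cap_pos
    by (cases i; auto intro!: fits_upd simp: input_symbol_def intro: le_trans[OF diff_le_self])+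
  then have "reaches (pc, R) 1 (Suc pc, ?R)" using Cons.prems(2) at by (intro reaches_step) simp_all
  from reaches_trans[OF this Cons.IH[OF at(3) step(2,3)]] show ?case by simp
qed

definition represents :: "(nat \<Rightarrow> nat) \<Rightarrow> store \<Rightarrow> bool" where
  "represents R s \<longleftrightarrow> fits B R \<and> R (addr Cap) = N \<and> R (addr Zero) = 0 \<and>
     (\<forall>l. R (loc_addr l) = s l \<and> s l \<le> N)"

lemma representsD:
  assumes "represents R s"
  shows "fits B R" "R (addr Cap) = N" "R (addr Zero) = 0" "R (loc_addr l) = s l" "s l \<le> N"
  using assms by (simp_all add: represents_def)

definition preserves_loops :: "nat \<Rightarrow> (nat \<Rightarrow> nat) \<Rightarrow> (nat \<Rightarrow> nat) \<Rightarrow> bool" where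
  "preserves_loops d R R' \<longleftrightarrow> (\<forall>e<d. R' (addr (Counter e)) = R (addr (Counter e)) \<and>
     R' (addr (Limit e)) = R (addr (Limit e)))"

lemma preserves_loops_trans:
  "preserves_loops d R R' \<Longrightarrow> preserves_loops d R' R'' \<Longrightarrow> preserves_loops d R R''"
  by (simp add: preserves_loops_def)

definition implements :: "com \<Rightarrow> nat \<Rightarrow> nat \<Rightarrow> bool" where
  "implements c d pc \<longleftrightarrow> (\<forall>R s. represents R s \<longrightarrow>
     (\<exists>R'. reaches (pc, R) (time N c) (pc + length (code c d pc), R') \<and>
        represents R' (sem w N c s) \<and> preserves_loops d R R'))"

lemma implementsE:
  assumes "implements c d pc" "represents R s"
  obtains R' where "reaches (pc, R) (time N c) (pc + length (code c d pc), R')"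
    "represents R' (sem w N c s)" "preserves_loops d R R'"
  using assms unfolding implements_def by blast

definition simulates_line :: "instr list \<Rightarrow> com \<Rightarrow> nat \<Rightarrow> (nat \<Rightarrow> nat) \<Rightarrow> store \<Rightarrow> bool" where
  "simulates_line k c d R s \<longleftrightarrow> straight_line k R \<and>
     (\<forall>l. exec_line k R (loc_addr l) = sem w N c s l) \<and> exec_line k R (addr Cap) = N \<and>
     exec_line k R (addr Zero) = 0 \<and> preserves_loops d R (exec_line k R)"

lemmas simulates_line_simps = simulates_line_def represents_def preserves_loops_def

lemma implements_line:
  assumes at: "code_at prog pc (code c d pc)" and time: "time N c = length (code c d pc)"
    and sim: "\<And>R s. represents R s \<Longrightarrow> simulates_line (code c d pc) c d R s"
  shows "implements c d pc"
  unfolding implements_def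
proof (intro allI impI)
  fix R s assume rep: "represents R s"
  let ?R = "exec_line (code c d pc) R"
  have reaches: "reaches (pc, R) (time N c) (pc + length (code c d pc), ?R)"
    unfolding time using sim[OF rep]
    by (intro reaches_line at representsD(1)[OF rep]) (simp add: simulates_line_def)
  then have "fits B ?R" using reaches_fits by fastforce
  moreover have "sem w N c s l \<le> N" for l
    using representsD(5)[OF rep] cap_pos by (intro sem_le) auto
  ultimately have "represents ?R (sem w N c s)" "preserves_loops d R ?R"
    using sim[OF rep] by (simp_all add: simulates_line_def represents_def)
  then show "\<exists>R'. reaches (pc, R) (time N c) (pc + length (code c d pc), R') \<and>
      represents R' (sem w N c s) \<and> preserves_loops d R R'"
    using reaches by blast
qed

lemma array_address:
  assumes "represents R s"
  shows "s x + s x + (s x + s x) + loc_addr (Arr a 0) = loc_addr (Arr a (s x))"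
    and "loc_addr (Arr a (s x)) \<le> B"
  using representsD(5)[OF assms, of x] addresses_le loc_addr_Arr_le[of a "s x"]
    loc_addr_Arr[of a "s x"] by simp_all

lemma sums_le:
  assumes "represents R s"
  shows "s x + s y \<le> B" "s x + s x + (s x + s x) \<le> B"
  using representsD(5)[OF assms, of x] representsD(5)[OF assms, of y] addresses_le by simp_all

lemma implements_Plus:
  assumes "code_at prog pc (code (Plus x y z) d pc)"
  shows "implements (Plus x y z) d pc"
proof (rule implements_line[OF assms])
  fix R s assume rep: "represents R s"
  show "simulates_line (code (Plus x y z) d pc) (Plus x y z) d R s"
    using rep sums_le(1)[OF rep] by (auto simp: simulates_line_simps)
qed simp

lemma implements_Get:
  assumes "code_at prog pc (code (Get a x y) d pc)"
  shows "implements (Get a x y) d pc"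
proof (rule implements_line[OF assms])
  fix R s assume rep: "represents R s"
  show "simulates_line (code (Get a x y) d pc) (Get a x y) d R s"
    using rep sums_le[OF rep] array_address[OF rep, where x = y and a = a]
    by (auto simp: simulates_line_simps)
qed simp

lemma implements_Put:
  assumes "code_at prog pc (code (Put a x y) d pc)"
  shows "implements (Put a x y) d pc"
proof (rule implements_line[OF assms])
  fix R s assume rep: "represents R s"
  show "simulates_line (code (Put a x y) d pc) (Put a x y) d R s"
    using rep sums_le[OF rep] array_address[OF rep, where x = x and a = a]
    by (auto simp: simulates_line_simps)
qed simp

lemma implements_Seq:
  assumes "implements c1 d pc" "implements c2 d (pc + length (code c1 d pc))"
  shows "implements (c1 ;; c2) d pc"
  unfolding implements_def
proof (intro allI impI)
  let ?pc = "pc + length (code c1 d pc)"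
  fix R s assume "represents R s"
  with assms(1) obtain R1 where R1: "reaches (pc, R) (time N c1) (?pc, R1)"
    "represents R1 (sem w N c1 s)" "preserves_loops d R R1"
    by (rule implementsE)
  from assms(2) R1(2) obtain R2 where
    R2: "reaches (?pc, R1) (time N c2) (?pc + length (code c2 d ?pc), R2)"
    "represents R2 (sem w N c2 (sem w N c1 s))" "preserves_loops d R1 R2"
    by (rule implementsE)
  show "\<exists>R'. reaches (pc, R) (time N (c1 ;; c2)) (pc + length (code (c1 ;; c2) d pc), R') \<and>
      represents R' (sem w N (c1 ;; c2) s) \<and> preserves_loops d R R'"
    using reaches_trans[OF R1(1) R2(1)] R2(2) preserves_loops_trans[OF R1(3) R2(3)]
    by (auto simp: add.assoc)
qed

lemma length_code_Cond:
  "pc + length (code (Cond x c1 c2) d pc) = pc + 2 + length (code c1 d (Suc pc)) +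
    length (code c2 d (pc + 2 + length (code c1 d (Suc pc))))"
  by (simp add: Let_def)

lemma cond_zero:
  assumes at: "code_at prog pc (code (Cond x c1 c2) d pc)"
    and c2: "implements c2 d (pc + 2 + length (code c1 d (Suc pc)))"
    and rep: "represents R s" and zero: "s x = 0"
  obtains R' where
    "reaches (pc, R) (1 + time N c2) (pc + length (code (Cond x c1 c2) d pc), R')"
    "represents R' (sem w N c2 s)" "preserves_loops d R R'"
proof -
  let ?pc2 = "pc + 2 + length (code c1 d (Suc pc))"
  have entry: "reaches (pc, R) 1 (?pc2, R)"
    using reaches_Jz[OF code_at_Cond(1)[OF at] representsD(1)[OF rep]] representsD(4)[OF rep] zero
    by simp
  obtain R' where body: "reaches (?pc2, R) (time N c2) (?pc2 + length (code c2 d ?pc2), R')"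
    and R': "represents R' (sem w N c2 s)" "preserves_loops d R R'"
    using c2 rep by (rule implementsE)
  have "reaches (pc, R) (1 + time N c2) (?pc2 + length (code c2 d ?pc2), R')"
    using entry body by (rule reaches_trans)
  then show thesis using that R' by (simp only: length_code_Cond)
qed

lemma cond_nonzero:
  assumes at: "code_at prog pc (code (Cond x c1 c2) d pc)" and c1: "implements c1 d (Suc pc)"
    and rep: "represents R s" and nonzero: "s x \<noteq> 0"
  obtains R' where
    "reaches (pc, R) (1 + (time N c1 + 1)) (pc + length (code (Cond x c1 c2) d pc), R')"
    "represents R' (sem w N c1 s)" "preserves_loops d R R'"
proof -
  let ?k1 = "code c1 d (Suc pc)"
  let ?end = "pc + 2 + length ?k1 + length (code c2 d (pc + 2 + length ?k1))"
  have entry: "reaches (pc, R) 1 (Suc pc, R)"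
    using reaches_Jz[OF code_at_Cond(1)[OF at] representsD(1)[OF rep]] representsD(4)[OF rep]
      nonzero by simp
  obtain R' where body: "reaches (Suc pc, R) (time N c1) (Suc pc + length ?k1, R')"
    and R': "represents R' (sem w N c1 s)" "preserves_loops d R R'"
    using c1 rep by (rule implementsE)
  have exit: "reaches (Suc pc + length ?k1, R') 1 (?end, R')"
    using reaches_Jz[OF code_at_Cond(3)[OF at] representsD(1)[OF R'(1)]] representsD(3)[OF R'(1)]
    by simp
  have "reaches (pc, R) (1 + (time N c1 + 1)) (?end, R')"
    by (rule reaches_trans[OF entry reaches_trans[OF body exit]])
  then show thesis using that R' by (simp only: length_code_Cond)
qed

lemma implements_Cond:
  assumes at: "code_at prog pc (code (Cond x c1 c2) d pc)"
    and c1: "implements c1 d (Suc pc)"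
    and c2: "implements c2 d (pc + 2 + length (code c1 d (Suc pc)))"
  shows "implements (Cond x c1 c2) d pc"
  unfolding implements_def
proof (intro allI impI)
  fix R s assume rep: "represents R s"
  let ?c = "Cond x c1 c2"
  let ?end = "pc + length (code ?c d pc)"
  show "\<exists>R'. reaches (pc, R) (time N ?c) (?end, R') \<and>
      represents R' (sem w N ?c s) \<and> preserves_loops d R R'"
  proof (cases "s x = 0")
    case True
    obtain R' where "reaches (pc, R) (1 + time N c2) (?end, R')"
      "represents R' (sem w N c2 s)" "preserves_loops d R R'"
      using cond_zero[OF at c2 rep True] .
    moreover have "1 + time N c2 \<le> time N ?c" by simp
    ultimately show ?thesis using reaches_mono True by (metis sem.simps(9))
  next
    case False
    obtain R' where "reaches (pc, R) (1 + (time N c1 + 1)) (?end, R')"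
      "represents R' (sem w N c1 s)" "preserves_loops d R R'"
      using cond_nonzero[OF at c1 rep False] .
    moreover have "1 + (time N c1 + 1) \<le> time N ?c" by simp
    ultimately show ?thesis using reaches_mono False by (metis sem.simps(9))
  qed
qed

lemma loop_exit:
  assumes at: "code_at prog pc (code (Loop x y c) d pc)" and rep: "represents R s"
    and exhausted: "R (addr (Counter d)) = R (addr (Limit d))"
  obtains R' where "reaches (pc + 2, R) 2 (pc + length (code (Loop x y c) d pc), R')"
    "represents R' s" "preserves_loops d R R'"
proof -
  let ?R = "R(addr Acc := 0)"
  have len: "pc + length (code (Loop x y c) d pc) = pc + 8 + length (code c (Suc d) (pc + 5))"
    by (simp add: Let_def)
  have test: "reaches (pc + 2, R) 1 (pc + 3, ?R)"
    using reaches_line[OF code_at_Loop(2)[OF at] representsD(1)[OF rep]] exhausted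
    by (simp add: eval_nat_numeral)
  then have fits: "fits B ?R" using reaches_fits by fastforce
  then have "reaches (pc + 3, ?R) 1 (pc + length (code (Loop x y c) d pc), ?R)"
    unfolding len using reaches_Jz[OF code_at_Loop(3)[OF at] fits] by simp
  from reaches_mono[OF reaches_trans[OF test this]]
  have "reaches (pc + 2, R) 2 (pc + length (code (Loop x y c) d pc), ?R)" by simp
  then show thesis
    by (rule that) (use rep fits in \<open>simp_all add: represents_def preserves_loops_def\<close>)
qed

lemma loop_enter:
  assumes at: "code_at prog pc (code (Loop x y c) d pc)" and rep: "represents R s"
    and index: "R (addr (Counter d)) = i" and limit: "R (addr (Limit d)) = L" "i < L" "L \<le> N"
  obtains R' where "reaches (pc + 2, R) 3 (pc + 5, R')" "represents R' (s(x := i))"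
    "preserves_loops (Suc d) R R'"
proof -
  let ?R1 = "R(addr Acc := L - i)" and ?R2 = "R(addr Acc := L - i, loc_addr x := i)"
  have test: "reaches (pc + 2, R) 1 (pc + 3, ?R1)"
    using reaches_line[OF code_at_Loop(2)[OF at] representsD(1)[OF rep]] index limit
    by (simp add: eval_nat_numeral)
  then have fits1: "fits B ?R1" using reaches_fits by fastforce
  then have stay: "reaches (pc + 3, ?R1) 1 (pc + 4, ?R1)"
    using reaches_Jz[OF code_at_Loop(3)[OF at] fits1] limit by (simp add: eval_nat_numeral)
  have assign: "reaches (pc + 4, ?R1) 1 (pc + 5, ?R2)"
    using reaches_line[OF code_at_Loop(4)[OF at] fits1] index limit addresses_le
      representsD(3)[OF rep] by (simp add: eval_nat_numeral)
  from reaches_mono[OF reaches_trans[OF test reaches_trans[OF stay assign]]]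
  have "reaches (pc + 2, R) 3 (pc + 5, ?R2)" by simp
  moreover have "fits B ?R2" using reaches_fits[OF assign] by simp
  then have "represents ?R2 (s(x := i))" using rep limit by (simp add: represents_def)
  ultimately show thesis using that[of ?R2] by (simp add: preserves_loops_def)
qed

lemma loop_back:
  assumes at: "code_at prog pc (code (Loop x y c) d pc)" and rep: "represents R s"
    and index: "R (addr (Counter d)) = i" "i < N"
  obtains R' where
    "reaches (pc + 5 + length (code c (Suc d) (pc + 5)), R) 3 (pc + 2, R')" "represents R' s"
    "R' (addr (Counter d)) = Suc i" "R' (addr (Limit d)) = R (addr (Limit d))"
    "preserves_loops d R R'"
proof -
  let ?k = "code c (Suc d) (pc + 5)"
  let ?R = "R(addr Acc := 1, addr (Counter d) := Suc i)"
  have "reaches (pc + 5 + length ?k, R) 2 (pc + 7 + length ?k, ?R)"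
    using reaches_line[OF code_at_Loop(6)[OF at] representsD(1)[OF rep]] index addresses_le
    by (simp add: eval_nat_numeral)
  moreover from this have fits: "fits B ?R" using reaches_fits by fastforce
  then have "reaches (pc + 7 + length ?k, ?R) 1 (pc + 2, ?R)"
    using reaches_Jz[OF code_at_Loop(7)[OF at] fits] representsD(3)[OF rep] by simp
  ultimately have "reaches (pc + 5 + length ?k, R) (2 + 1) (pc + 2, ?R)" by (rule reaches_trans)
  then have "reaches (pc + 5 + length ?k, R) 3 (pc + 2, ?R)" by (rule reaches_mono) simp
  then show thesis
    by (rule that) (use rep index fits in \<open>simp_all add: represents_def preserves_loops_def\<close>)
qed

lemma loop_iteration:
  assumes at: "code_at prog pc (code (Loop x y c) d pc)" and body: "implements c (Suc d) (pc + 5)"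
    and rep: "represents R s"
    and index: "R (addr (Counter d)) = i" and limit: "R (addr (Limit d)) = L" "i < L" "L \<le> N"
  obtains R' where "reaches (pc + 2, R) (time N c + 6) (pc + 2, R')"
    "represents R' (sem w N c (s(x := i)))"
    "R' (addr (Counter d)) = Suc i" "R' (addr (Limit d)) = L" "preserves_loops d R R'"
proof -
  obtain R1 where R1: "reaches (pc + 2, R) 3 (pc + 5, R1)" "represents R1 (s(x := i))"
    "preserves_loops (Suc d) R R1"
    using loop_enter[OF at rep index limit] .
  obtain R2 where
    R2: "reaches (pc + 5, R1) (time N c) (pc + 5 + length (code c (Suc d) (pc + 5)), R2)"
    "represents R2 (sem w N c (s(x := i)))" "preserves_loops (Suc d) R1 R2"
    using implementsE[OF body R1(2)] .
  have kept: "preserves_loops (Suc d) R R2" using R1(3) R2(3) by (rule preserves_loops_trans)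
  then have "R2 (addr (Counter d)) = i" "i < N" "R2 (addr (Limit d)) = L"
    using index limit by (auto simp: preserves_loops_def)
  with loop_back[OF at R2(2) this(1,2)] obtain R3 where
    R3: "reaches (pc + 5 + length (code c (Suc d) (pc + 5)), R2) 3 (pc + 2, R3)"
    "represents R3 (sem w N c (s(x := i)))" "R3 (addr (Counter d)) = Suc i"
    "R3 (addr (Limit d)) = L" "preserves_loops d R2 R3"
    by metis
  have "reaches (pc + 2, R) (3 + (time N c + 3)) (pc + 2, R3)"
    by (rule reaches_trans[OF R1(1) reaches_trans[OF R2(1) R3(1)]])
  then have "reaches (pc + 2, R) (time N c + 6) (pc + 2, R3)" by (rule reaches_mono) simp
  moreover have "preserves_loops d R R3" using kept R3(5) by (simp add: preserves_loops_def)
  ultimately show thesis using that R3 by blast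
qed

lemma loop_init:
  assumes at: "code_at prog pc (code (Loop x y c) d pc)" and rep: "represents R s"
  obtains R' where "reaches (pc, R) 2 (pc + 2, R')" "represents R' s"
    "R' (addr (Counter d)) = 0" "R' (addr (Limit d)) = s y" "preserves_loops d R R'"
proof -
  let ?R = "R(addr (Counter d) := 0, addr (Limit d) := s y)"
  have "s y \<le> B" using representsD(5)[OF rep, of y] addresses_le by simp
  then have "reaches (pc, R) 2 (pc + 2, ?R)"
    using reaches_line[OF code_at_Loop(1)[OF at] representsD(1)[OF rep]] representsD(3,4)[OF rep]
    by (simp add: eval_nat_numeral)
  moreover from this have "fits B ?R" using reaches_fits by fastforce
  ultimately show thesis using that[of ?R] rep by (simp add: represents_def preserves_loops_def)
qed

lemma implements_Loop:
  assumes at: "code_at prog pc (code (Loop x y c) d pc)" and body: "implements c (Suc d) (pc + 5)"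
  shows "implements (Loop x y c) d pc"
  unfolding implements_def
proof (intro allI impI)
  fix R s assume rep: "represents R s"
  let ?iterate = "\<lambda>i. fold (\<lambda>i s'. sem w N c (s'(x := i))) [0..<i] s"
  let ?I = "\<lambda>i cf. fst cf = pc + 2 \<and> represents (snd cf) (?iterate i) \<and>
    snd cf (addr (Counter d)) = i \<and> snd cf (addr (Limit d)) = s y \<and> preserves_loops d R (snd cf)"
  have limit: "s y \<le> N" using representsD(5)[OF rep] .
  obtain R0 where R0: "reaches (pc, R) 2 (pc + 2, R0)" "represents R0 s"
    "R0 (addr (Counter d)) = 0" "R0 (addr (Limit d)) = s y" "preserves_loops d R R0"
    using loop_init[OF at rep] .
  obtain cf where cf: "reaches (pc + 2, R0) (s y * (time N c + 6)) cf" "?I (s y) cf"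
  proof (rule reaches_iterate[where I = ?I and cf = "(pc + 2, R0)" and M = "s y"])
    fix i cf assume i: "i < s y" and I: "?I i cf"
    obtain R' where "reaches (pc + 2, snd cf) (time N c + 6) (pc + 2, R')"
      "represents R' (sem w N c ((?iterate i)(x := i)))" "R' (addr (Counter d)) = Suc i"
      "R' (addr (Limit d)) = s y" "preserves_loops d (snd cf) R'"
      using loop_iteration[OF at body, of "snd cf" "?iterate i" i "s y"] I i limit by blast
    then show "\<exists>cf'. reaches cf (time N c + 6) cf' \<and> ?I (Suc i) cf'"
      using I by (intro exI[of _ "(pc + 2, R')"]) (cases cf, auto intro: preserves_loops_trans)
  qed (use R0 representsD(1)[OF R0(2)] in auto)
  obtain R' where R': "reaches cf 2 (pc + length (code (Loop x y c) d pc), R')"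
    "represents R' (?iterate (s y))" "preserves_loops d (snd cf) R'"
    using loop_exit[OF at, of "snd cf" "?iterate (s y)"] cf(2) by (metis prod.collapse)
  have "s y * (time N c + 6) \<le> N * (time N c + 6)" using limit by (rule mult_le_mono1)
  then have "2 + (s y * (time N c + 6) + 2) \<le> time N (Loop x y c)" by simp
  with reaches_trans[OF R0(1) reaches_trans[OF cf(1) R'(1)]]
  have "reaches (pc, R) (time N (Loop x y c)) (pc + length (code (Loop x y c) d pc), R')"
    by (rule reaches_mono)
  moreover have "preserves_loops d R R'" using cf(2) R'(3) by (auto intro: preserves_loops_trans)
  ultimately show "\<exists>R'. reaches (pc, R) (time N (Loop x y c))
        (pc + length (code (Loop x y c) d pc), R') \<and>
      represents R' (sem w N (Loop x y c) s) \<and> preserves_loops d R R'"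
    using R'(2) by (auto simp: sem_Loop)
qed

lemma implements_code: "code_at prog pc (code c d pc) \<Longrightarrow> implements c d pc"
proof (induction c arbitrary: d pc)
  case Skip
  then show ?case by (intro implements_line) (auto simp: simulates_line_simps)
next
  case (Flag x b)
  then show ?case by (intro implements_line) (auto simp: simulates_line_simps)
next
  case (Minus x y z)
  then show ?case by (intro implements_line) (auto simp: simulates_line_simps)
next
  case (Input b x y)
  then show ?case by (intro implements_line) (auto simp: simulates_line_simps)
next
  case (Seq c1 c2)
  then show ?case by (intro implements_Seq) simp_all
next
  case (Cond x c1 c2)
  then show ?case by (intro implements_Cond Cond.IH code_at_Cond(2,4)) simp_all
next
  case (Loop x y c)
  then show ?case by (intro implements_Loop Loop.IH code_at_Loop(5)) simp_all
qed (rule implements_Plus implements_Get implements_Put, assumption)+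

end


section \<open>Polynomial bounds\<close>

lemma bigo_power_mono: "d \<le> e \<Longrightarrow> (\<lambda>n. real n ^ d) \<in> O(\<lambda>n. real n ^ e)"
  by (intro bigoI[where c = 1] eventually_sequentiallyI[of 1]) (auto intro: power_increasing)

lemma poly_bounded_const [simp]: "poly_bounded (\<lambda>_. c)"
  unfolding poly_bounded_def by (intro exI[of _ 0]) simp

lemma poly_bounded_ident [simp]: "poly_bounded (\<lambda>n. n)"
  unfolding poly_bounded_def by (intro exI[of _ 1]) simp

lemma poly_bounded_add [simp]:
  assumes "poly_bounded f" "poly_bounded g"
  shows "poly_bounded (\<lambda>n. f n + g n)"
proof -
  obtain d e where "(\<lambda>n. real (f n)) \<in> O(\<lambda>n. real n ^ d)" "(\<lambda>n. real (g n)) \<in> O(\<lambda>n. real n ^ e)"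
    using assms by (auto simp: poly_bounded_def)
  then have "(\<lambda>n. real (f n)) \<in> O(\<lambda>n. real n ^ (d + e))"
    "(\<lambda>n. real (g n)) \<in> O(\<lambda>n. real n ^ (d + e))"
    by (auto intro: landau_o.big_trans[OF _ bigo_power_mono])
  then have "(\<lambda>n. real (f n + g n)) \<in> O(\<lambda>n. real n ^ (d + e))"
    unfolding of_nat_add by (rule sum_in_bigo)
  then show ?thesis unfolding poly_bounded_def by blast
qed

lemma poly_bounded_mult [simp]:
  assumes "poly_bounded f" "poly_bounded g"
  shows "poly_bounded (\<lambda>n. f n * g n)"
proof -
  obtain d e where "(\<lambda>n. real (f n)) \<in> O(\<lambda>n. real n ^ d)" "(\<lambda>n. real (g n)) \<in> O(\<lambda>n. real n ^ e)"
    using assms by (auto simp: poly_bounded_def)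
  then have "(\<lambda>n. real (f n) * real (g n)) \<in> O(\<lambda>n. real n ^ d * real n ^ e)"
    by (rule landau_o.big.mult)
  then have "(\<lambda>n. real (f n * g n)) \<in> O(\<lambda>n. real n ^ (d + e))"
    by (simp add: power_add)
  then show ?thesis unfolding poly_bounded_def by blast
qed

lemma poly_bounded_Suc [simp]: "poly_bounded f \<Longrightarrow> poly_bounded (\<lambda>n. Suc (f n))"
  using poly_bounded_add[of f "\<lambda>_. 1"] by simp

lemma poly_bounded_time [simp]: "poly_bounded f \<Longrightarrow> poly_bounded (\<lambda>n. time (f n) c)"
  by (induction c) simp_all


section \<open>Resources of complete programs\<close>

lemma bit_length_le: "m \<le> B \<Longrightarrow> bit_length m \<le> Suc B"
proof -
  assume "m \<le> B"
  moreover have "floor_log m \<le> m"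
  proof (cases "m = 0")
    case False
    then have "2 ^ floor_log m \<le> m" by (intro floor_log_exp2_le) simp
    then show ?thesis using less_exp[of "floor_log m"] by linarith
  qed simp
  ultimately show ?thesis by (simp add: bit_length_def)
qed

lemma config_space_le:
  assumes "fits B (snd cf)"
  shows "config_space cf \<le> 2 * Suc B * Suc B"
proof -
  have "{a. snd cf a \<noteq> 0} \<subseteq> {..B}" using assms by (auto simp: fits_def not_less[symmetric])
  then have "config_space cf \<le> (\<Sum>a\<in>{..B}. bit_length a + bit_length (snd cf a))"
    unfolding config_space_def by (intro sum_mono2) auto
  also have "\<dots> \<le> (\<Sum>a\<in>{..B}. Suc B + Suc B)"
    using assms by (intro sum_mono add_mono bit_length_le) (auto simp: fits_def)
  finally show ?thesis by (simp add: algebra_simps)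
qed

lemma instr_cost_le:
  assumes "fits B R" "operand_bound i \<le> B"
  shows "instr_cost i R \<le> 5 * Suc B"
proof -
  have R: "bit_length (R a) \<le> Suc B" for a
    using assms(1) by (intro bit_length_le) (simp add: fits_def)
  note operand = bit_length_le[of _ B]
  show ?thesis
  proof (cases i)
    case (Const d c)
    then show ?thesis using operand[of d] operand[of c] assms(2) by simp
  next
    case (Add d a b)
    then show ?thesis
      using operand[of d] operand[of a] operand[of b] R[of a] R[of b] assms(2) by simp
  next
    case (Sub d a b)
    then show ?thesis
      using operand[of d] operand[of a] operand[of b] R[of a] R[of b] assms(2) by simp
  next
    case (Load d a)
    then show ?thesis using operand[of d] operand[of a] R[of a] R[of "R a"] assms(2) by simp
  next
    case (Store d a)
    then show ?thesis using operand[of d] operand[of a] R[of d] R[of a] assms(2) by simp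
  next
    case (Read d a)
    then show ?thesis using operand[of d] operand[of a] R[of a] assms(2) by simp
  next
    case (Jz a t)
    then show ?thesis using operand[of a] R[of a] assms(2) by simp
  qed
qed

text \<open>
  The cap is the largest position of the input that is ever inspected, which is that of digit
  \<open>n + 1\<close> of p. It is accumulated by \<open>count_vertices\<close> in steps of \<open>2 * n + 4\<close>.
\<close>

definition cap :: "nat \<Rightarrow> nat" where
  "cap n = Suc n * (n + 2)"

definition count_vertices :: "instr list" where
  "count_vertices =
    [Const (addr Cap) 2,
     Read (addr Acc) (loc_addr (Var Order)), Jz (addr Acc) 10,
     Add (addr Cap) (addr Cap) (loc_addr (Var Order)),
     Add (addr Cap) (addr Cap) (loc_addr (Var Order)),
     Const (addr Acc) 4, Add (addr Cap) (addr Cap) (addr Acc),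
     Const (addr Acc) 1, Add (loc_addr (Var Order)) (loc_addr (Var Order)) (addr Acc),
     Jz (addr Zero) 1]"

definition complete_program :: "com \<Rightarrow> com \<Rightarrow> loc \<Rightarrow> com \<Rightarrow> instr list" where
  "complete_program init body x final =
    (let k1 = code init 0 10; pc1 = 10 + length k1; k2 = code body 0 pc1 in
     count_vertices @ k1 @ k2 @ [Jz (loc_addr x) pc1] @
     code final 0 (Suc (pc1 + length k2)))"

definition initial_store :: "nat \<Rightarrow> store" where
  "initial_store n = (\<lambda>_. 0)(Var Order := n)"

lemma cap_Suc: "cap (Suc n) = cap n + n + n + 4"
  by (simp add: cap_def)

lemma cap_mono: "m \<le> n \<Longrightarrow> cap m \<le> cap n"
  unfolding cap_def by (intro mult_le_mono) simp_all

lemma Suc_less_cap: "Suc n < cap n"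
  by (simp add: cap_def)

lemma one_le_cap [simp]: "Suc 0 \<le> cap n"
  by (simp add: cap_def)

lemma poly_bounded_cap [simp]: "poly_bounded cap"
  unfolding cap_def[abs_def] by simp

context machine
begin

definition counted :: "nat \<Rightarrow> (nat \<Rightarrow> nat) \<Rightarrow> bool" where
  "counted j R \<longleftrightarrow> R (addr Cap) = cap j \<and> R (loc_addr (Var Order)) = j \<and>
     (\<forall>a. a \<notin> {addr Cap, loc_addr (Var Order), addr Acc} \<longrightarrow> R a = 0)"

lemma reaches_read_unary:
  assumes at: "code_at prog 0 count_vertices" and R: "counted j R" "fits B R"
  shows "reaches (1, R) 2
    (if input_symbol w j = 0 then 10 else 3, R(addr Acc := input_symbol w j))"
proof -
  let ?R = "R(addr Acc := input_symbol w j)"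
  have parts: "code_at prog 1 [Read (addr Acc) (loc_addr (Var Order))]"
      "code_at prog 2 [Jz (addr Acc) 10]"
    using at by (simp_all add: count_vertices_def eval_nat_numeral)
  have read: "reaches (1, R) 1 (2, ?R)"
    using reaches_line[OF parts(1) R(2)] R(1) by (simp add: counted_def eval_nat_numeral)
  then have "fits B ?R" using reaches_fits by fastforce
  from reaches_Jz[OF parts(2) this]
  have "reaches (2, ?R) 1 (if input_symbol w j = 0 then 10 else 3, ?R)"
    by (cases "input_symbol w j = 0") (simp_all add: eval_nat_numeral)
  from reaches_mono[OF reaches_trans[OF read this]] show ?thesis by simp
qed

lemma reaches_count_vertex:
  assumes at: "code_at prog 0 count_vertices" and R: "counted j R" "fits B R"
    and one: "input_symbol w j = 1" and le: "cap (Suc j) \<le> N"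
  obtains R' where "reaches (1, R) 9 (1, R')" "counted (Suc j) R'"
proof -
  let ?order = "loc_addr (Var Order)"
  let ?R1 = "R(addr Acc := 1)"
  let ?R2 = "R(addr Cap := cap (Suc j), addr Acc := 1, ?order := Suc j)"
  let ?update = "[Add (addr Cap) (addr Cap) ?order, Add (addr Cap) (addr Cap) ?order,
    Const (addr Acc) 4, Add (addr Cap) (addr Cap) (addr Acc),
    Const (addr Acc) 1, Add ?order ?order (addr Acc)]"
  have parts: "code_at prog 3 ?update" "code_at prog 9 [Jz (addr Zero) 1]"
    using at by (simp_all add: count_vertices_def eval_nat_numeral)
  have read: "reaches (1, R) 2 (3, ?R1)" using reaches_read_unary[OF at R] one by simp
  then have fits: "fits B ?R1" using reaches_fits by fastforce
  have "cap j + j + j + 4 \<le> B" "Suc j \<le> B"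
    using le Suc_less_cap[of "Suc j"] addresses_le by (simp_all add: cap_Suc)
  then have "reaches (3, ?R1) (length ?update) (9, ?R2)"
    using reaches_line[OF parts(1) fits] R(1)
    by (simp add: counted_def cap_Suc fun_upd_twist eval_nat_numeral)
  then have update: "reaches (3, ?R1) 6 (9, ?R2)" by (simp add: eval_nat_numeral)
  have "fits B ?R2" using reaches_fits[OF update] by simp
  moreover have "?R2 (addr Zero) = 0" using R(1) by (simp add: counted_def)
  ultimately have jump: "reaches (9, ?R2) 1 (1, ?R2)"
    using reaches_Jz[OF parts(2), of ?R2] by simp
  from reaches_mono[OF reaches_trans[OF read reaches_trans[OF update jump]]]
  have "reaches (1, R) 9 (1, ?R2)" by simp
  then show thesis by (rule that) (use R(1) in \<open>simp add: counted_def\<close>)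
qed

lemma reaches_count_vertices:
  assumes at: "code_at prog 0 count_vertices" and N: "N = cap n"
    and unary: "\<And>i. i \<le> n \<Longrightarrow> input_symbol w i = of_bool (i < n)"
  obtains R where "reaches (0, \<lambda>_. 0) (9 * n + 3) (10, R)" "represents R (initial_store n)"
proof -
  let ?R0 = "(\<lambda>_. 0)(addr Cap := 2)"
  have "code_at prog 0 [Const (addr Cap) 2]" "fits B (\<lambda>_. 0)"
    using at by (simp_all add: count_vertices_def fits_def)
  from reaches_line[OF this] have init: "reaches (0, \<lambda>_. 0) 1 (1, ?R0)" by simp
  obtain cf where cf: "reaches (1, ?R0) (n * 9) cf" "fst cf = 1 \<and> counted n (snd cf)"
  proof (rule reaches_iterate[where I = "\<lambda>j cf. fst cf = 1 \<and> counted j (snd cf)"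
        and cf = "(1, ?R0)" and M = n])
    fix j and cf :: config
    assume j: "j < n" and cf: "fst cf = 1 \<and> counted j (snd cf)" "fits B (snd cf)"
    have "cap (Suc j) \<le> N" unfolding N using j by (intro cap_mono) simp
    then obtain R' where "reaches (1, snd cf) 9 (1, R')" "counted (Suc j) R'"
      using reaches_count_vertex[OF at, of j "snd cf"] cf unary[of j] j by auto
    then show "\<exists>cf'. reaches cf 9 cf' \<and> fst cf' = 1 \<and> counted (Suc j) (snd cf')"
      using cf by (intro exI[of _ "(1, R')"]) (cases cf, simp)
  qed (use reaches_fits[OF init] in \<open>simp_all add: counted_def cap_def\<close>)
  define R where "R = (snd cf)(addr Acc := 0)"
  have "reaches cf 2 (10, R)"
    using reaches_read_unary[OF at, of n "snd cf"] cf reaches_fits[OF cf(1)] unary[of n]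
    by (cases cf) (simp add: R_def)
  from reaches_mono[OF reaches_trans[OF init reaches_trans[OF cf(1) this]]]
  have reaches: "reaches (0, \<lambda>_. 0) (9 * n + 3) (10, R)" by simp
  have "R (addr r) = 0" if "r \<notin> {Cap, Loc (Var Order)}" for r
    using cf(2) that by (simp add: R_def counted_def)
  moreover have "R (addr Cap) = N" "R (loc_addr (Var Order)) = n"
    using cf(2) by (simp_all add: R_def counted_def N)
  ultimately have "represents R (initial_store n)"
    using reaches_fits[OF reaches] Suc_less_cap[of n] N
    unfolding represents_def initial_store_def by simp
  with reaches show thesis by (rule that)
qed

lemma reaches_repeat:
  assumes at: "code_at prog pc (code c 0 pc)"
      "code_at prog (pc + length (code c 0 pc)) [Jz (loc_addr x) pc]"
    and rep: "represents R s"
    and M: "0 < M" "(sem w N c ^^ M) s x \<noteq> 0" "\<And>j. 0 < j \<Longrightarrow> j < M \<Longrightarrow> (sem w N c ^^ j) s x = 0"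
  obtains R' where
    "reaches (pc, R) (M * (time N c + 1)) (Suc (pc + length (code c 0 pc)), R')"
    "represents R' ((sem w N c ^^ M) s)"
proof -
  let ?st = "\<lambda>j. (sem w N c ^^ j) s"
  let ?end = "pc + length (code c 0 pc)"
  let ?I = "\<lambda>j cf. fst cf = (if j = M then Suc ?end else pc) \<and> represents (snd cf) (?st j)"
  obtain cf where "reaches (pc, R) (M * (time N c + 1)) cf" "?I M cf"
  proof (rule reaches_iterate[where I = ?I and cf = "(pc, R)" and M = M])
    fix j cf assume j: "j < M" and cf: "?I j cf"
    obtain R1 where R1: "reaches (pc, snd cf) (time N c) (?end, R1)" "represents R1 (?st (Suc j))"
      using implementsE[OF implements_code[OF at(1)], of "snd cf" "?st j"] cf by auto
    have "?st (Suc j) x = 0 \<longleftrightarrow> Suc j \<noteq> M" using M(2) M(3)[of "Suc j"] j by (cases "Suc j = M") auto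
    then have "reaches (?end, R1) 1 (if Suc j = M then Suc ?end else pc, R1)"
      using reaches_Jz[OF at(2) representsD(1)[OF R1(2)]] representsD(4)[OF R1(2)]
      by (cases "Suc j = M") simp_all
    from reaches_trans[OF R1(1) this]
    show "\<exists>cf'. reaches cf (time N c + 1) cf' \<and> ?I (Suc j) cf'"
      using R1(2) cf j
      by (intro exI[of _ "(if Suc j = M then Suc ?end else pc, R1)"]) (cases cf, auto)
  qed (use rep M(1) representsD(1) in auto)
  then show thesis using that by (cases cf) auto
qed

lemma code_at_complete_program:
  assumes "prog = complete_program init body x final"
  defines "pc1 \<equiv> 10 + length (code init 0 10)"
  defines "pc2 \<equiv> pc1 + length (code body 0 pc1)"
  shows "code_at prog 0 count_vertices" and "code_at prog 10 (code init 0 10)"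
    and "code_at prog pc1 (code body 0 pc1)" and "code_at prog pc2 [Jz (loc_addr x) pc1]"
    and "code_at prog (Suc pc2) (code final 0 (Suc pc2))"
    and "length prog = Suc pc2 + length (code final 0 (Suc pc2))"
proof -
  have len: "length count_vertices = 10" by (simp add: count_vertices_def)
  have "code_at prog 0 (complete_program init body x final)"
    using assms(1) code_at_self by simp
  then show "code_at prog 0 count_vertices" "code_at prog 10 (code init 0 10)"
    "code_at prog pc1 (code body 0 pc1)" "code_at prog pc2 [Jz (loc_addr x) pc1]"
    "code_at prog (Suc pc2) (code final 0 (Suc pc2))"
    by (simp_all add: complete_program_def Let_def len pc1_def pc2_def add.assoc)
  show "length prog = Suc pc2 + length (code final 0 (Suc pc2))"
    unfolding assms(1) by (simp add: complete_program_def Let_def len pc1_def pc2_def)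
qed

lemma reaches_complete_program:
  assumes prog: "prog = complete_program init body x final" and N: "N = cap n"
    and unary: "\<And>i. i \<le> n \<Longrightarrow> input_symbol w i = of_bool (i < n)"
    and st: "\<And>j. st j = (sem w N body ^^ j) (sem w N init (initial_store n))"
    and M: "0 < M" "st M x \<noteq> 0" "\<And>j. 0 < j \<Longrightarrow> j < M \<Longrightarrow> st j x = 0"
  obtains R where
    "reaches (0, \<lambda>_. 0) (9 * n + 3 + time N init + M * (time N body + 1) + time N final)
      (length prog, R)"
    "represents R (sem w N final (st M))"
proof -
  let ?pc1 = "10 + length (code init 0 10)"
  let ?pc2 = "?pc1 + length (code body 0 ?pc1)"
  note at = code_at_complete_program[OF prog]
  obtain R0 where R0: "reaches (0, \<lambda>_. 0) (9 * n + 3) (10, R0)" "represents R0 (initial_store n)"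
    using reaches_count_vertices[OF at(1) N unary] .
  obtain R1 where R1: "reaches (10, R0) (time N init) (?pc1, R1)"
    "represents R1 (sem w N init (initial_store n))"
    using implementsE[OF implements_code[OF at(2)] R0(2)] .
  obtain R2 where R2: "reaches (?pc1, R1) (M * (time N body + 1)) (Suc ?pc2, R2)"
    "represents R2 (st M)"
    using reaches_repeat[OF at(3,4) R1(2) M[unfolded st]] unfolding st .
  obtain R3 where R3: "reaches (Suc ?pc2, R2) (time N final) (length prog, R3)"
    "represents R3 (sem w N final (st M))"
    using implementsE[OF implements_code[OF at(5)] R2(2)] unfolding at(6) .
  from reaches_trans[OF reaches_trans[OF reaches_trans[OF R0(1) R1(1)] R2(1)] R3(1)] R3(2)
  show thesis by (rule that)
qed

lemma decides_within_if_reaches: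
  assumes "reaches (0, \<lambda>_. 0) T (length prog, R)" "R 0 = of_bool ans"
  shows "decides_within prog w ans (T * (5 * Suc B)) (2 * Suc B * Suc B)"
proof -
  obtain m where m: "m \<le> T" "config_after prog w m = (length prog, R)"
    and fits: "\<And>i. i \<le> m \<Longrightarrow> fits B (snd (config_after prog w i))"
    using assms(1) by (auto simp: reaches_def config_after_def)
  have "step_cost prog (config_after prog w i) \<le> 5 * Suc B" if "i < m" for i
    using that fits[of i] operand_bound_le
    by (auto simp: step_cost_def halted_def simp del: mult_Suc_right intro!: instr_cost_le)
  then have "(\<Sum>i<m. step_cost prog (config_after prog w i)) \<le> m * (5 * Suc B)"
    using sum_bounded_above[of "{..<m}" _ "5 * Suc B"] by simp
  also have "\<dots> \<le> T * (5 * Suc B)" using m(1) by (rule mult_le_mono1)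
  finally show ?thesis
    unfolding decides_within_def using m(2) assms(2) config_space_le[OF fits]
    by (intro exI[of _ m]) (auto simp: halted_def)
qed

end

definition register_bound :: "instr list \<Rightarrow> nat \<Rightarrow> nat" where
  "register_bound prog n = 4 * cap n + 3 + Max (operand_bound ` set prog)"

definition round_time :: "com \<Rightarrow> com \<Rightarrow> loc \<Rightarrow> com \<Rightarrow> nat \<Rightarrow> nat" where
  "round_time init body x final n =
     (9 * n + 3 + time (cap n) init + (time (cap n) body + 1) + time (cap n) final) *
     (5 * Suc (register_bound (complete_program init body x final) n))"

definition program_space :: "instr list \<Rightarrow> nat \<Rightarrow> nat" where
  "program_space prog n = 2 * Suc (register_bound prog n) * Suc (register_bound prog n)"

lemma machine_register_bound: "machine prog (cap n) (register_bound prog n)"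
  by unfold_locales (auto simp: register_bound_def cap_def intro!: trans_le_add2 Max_ge)

lemma poly_bounded_register_bound [simp]: "poly_bounded (register_bound prog)"
  unfolding register_bound_def[abs_def] by simp

lemma poly_bounded_round_time: "poly_bounded (round_time init body x final)"
  unfolding round_time_def[abs_def] by simp

lemma poly_bounded_program_space: "poly_bounded (program_space prog)"
  unfolding program_space_def[abs_def] by simp

lemma decides_within_mono:
  "decides_within prog w ans T S \<Longrightarrow> T \<le> T' \<Longrightarrow> S \<le> S' \<Longrightarrow> decides_within prog w ans T' S'"
  unfolding decides_within_def by (meson le_trans)

lemma complete_program_decides_within:
  fixes init body final :: com and x :: loc
  defines "prog \<equiv> complete_program init body x final"
  assumes unary: "\<And>i. i \<le> n \<Longrightarrow> input_symbol w i = of_bool (i < n)"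
    and st: "\<And>j. st j =
      (sem w (cap n) body ^^ j) (sem w (cap n) init (initial_store n))"
    and M: "0 < M" "st M x \<noteq> 0" "\<And>j. 0 < j \<Longrightarrow> j < M \<Longrightarrow> st j x = 0"
    and ans: "sem w (cap n) final (st M) (Var Answer) = of_bool ans"
  shows "decides_within prog w ans (M * round_time init body x final n) (program_space prog n)"
proof -
  interpret machine prog w "cap n" "register_bound prog n" by (rule machine_register_bound)
  let ?T = "9 * n + 3 + time (cap n) init + M * (time (cap n) body + 1) + time (cap n) final"
  obtain R where R: "reaches (0, \<lambda>_. 0) ?T (length prog, R)"
    "represents R (sem w (cap n) final (st M))"
    using reaches_complete_program[OF prog_def[THEN meta_eq_to_obj_eq] refl unary st M] .
  have "R 0 = of_bool ans"
    using representsD(4)[OF R(2), of "Var Answer"] ans by (simp add: loc_addr_Answer)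
  from decides_within_if_reaches[OF R(1) this] show ?thesis
  proof (rule decides_within_mono)
    have "9 * n + 3 + time (cap n) init + time (cap n) final \<le>
        M * (9 * n + 3 + time (cap n) init + time (cap n) final)"
      using M(1) by simp
    then have "?T \<le> M * (9 * n + 3 + time (cap n) init + (time (cap n) body + 1) +
        time (cap n) final)"
      by (simp add: algebra_simps)
    then show "?T * (5 * Suc (register_bound prog n)) \<le> M * round_time init body x final n"
      unfolding round_time_def prog_def mult.assoc[symmetric] by (intro mult_le_mono1)
  qed (simp add: program_space_def)
qed


section \<open>Evaluating first-order formulas\<close>

text \<open>
  \<open>Symbol b x y\<close> reads the input as a table with n columns behind the unary length, whose
  rows are the adjacency matrix, the characteristic vector of X, and the digits of p.
\<close>

datatype fm =
    Symbol nat var var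
  | Mem array var
  | Less var var
  | Neg fm
  | Conj fm fm
  | Forall fm

abbreviation Imp :: "fm \<Rightarrow> fm \<Rightarrow> fm" where "Imp f g \<equiv> Neg (Conj f (Neg g))"
abbreviation Iff :: "fm \<Rightarrow> fm \<Rightarrow> fm" where "Iff f g \<equiv> Conj (Imp f g) (Imp g f)"

definition cell_pos :: "nat \<Rightarrow> nat \<Rightarrow> nat \<Rightarrow> nat" where
  "cell_pos n i j = n + 1 + i * n + j"

primrec holds :: "bool list \<Rightarrow> nat \<Rightarrow> nat \<Rightarrow> fm \<Rightarrow> store \<Rightarrow> bool" where
  "holds w N q (Symbol b x y) s \<longleftrightarrow>
     input_symbol w (min N (cell_pos (s (Var Order)) (s (Var x)) (s (Var y)))) = b"
| holds_Mem: "holds w N q (Mem a x) s \<longleftrightarrow> s (Arr a (s (Var x))) \<noteq> 0"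
| "holds w N q (Less x y) s \<longleftrightarrow> s (Var x) < s (Var y)"
| "holds w N q (Neg f) s \<longleftrightarrow> \<not> holds w N q f s"
| "holds w N q (Conj f g) s \<longleftrightarrow> holds w N q f s \<and> holds w N q g s"
| "holds w N q (Forall f) s \<longleftrightarrow> (\<forall>i<s (Var Order). holds w N (Suc q) f (s(Var (Bound q) := i)))"

definition Neq :: "var \<Rightarrow> var \<Rightarrow> fm" where
  "Neq x y = Imp (Neg (Less x y)) (Less y x)"

lemma holds_Neq [simp]: "holds w N q (Neq x y) s \<longleftrightarrow> s (Var x) \<noteq> s (Var y)"
  by (auto simp: Neq_def)

definition in_scope :: "nat \<Rightarrow> var \<Rightarrow> bool" where
  "in_scope q x \<longleftrightarrow> (\<forall>j. x = Bound j \<longrightarrow> j < q)"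

primrec wf_fm :: "nat \<Rightarrow> fm \<Rightarrow> bool" where
  "wf_fm q (Symbol b x y) \<longleftrightarrow> in_scope q x \<and> in_scope q y"
| "wf_fm q (Mem a x) \<longleftrightarrow> in_scope q x"
| "wf_fm q (Less x y) \<longleftrightarrow> in_scope q x \<and> in_scope q y"
| "wf_fm q (Neg f) \<longleftrightarrow> wf_fm q f"
| "wf_fm q (Conj f g) \<longleftrightarrow> wf_fm q f \<and> wf_fm q g"
| "wf_fm q (Forall f) \<longleftrightarrow> wf_fm (Suc q) f"

lemma wf_fm_Neq [simp]: "wf_fm q (Neq x y) \<longleftrightarrow> in_scope q x \<and> in_scope q y"
  by (auto simp: Neq_def)

definition normalize :: "loc \<Rightarrow> com" where
  "normalize x = Cond x (Flag x True) (Flag x False)"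

primrec compute :: "nat \<Rightarrow> fm \<Rightarrow> com" where
  "compute q (Symbol b x y) =
     Flag (Tmp q) True ;;
     Loop (Tmp (Suc q)) (Var x) (Plus (Tmp q) (Tmp q) (Var Order)) ;;
     Plus (Tmp q) (Tmp q) (Var Order) ;;
     Plus (Tmp q) (Tmp q) (Var y) ;;
     Input b (Tmp q) (Tmp q)"
| "compute q (Mem a x) = Get a (Tmp q) (Var x) ;; normalize (Tmp q)"
| "compute q (Less x y) = Minus (Tmp q) (Var y) (Var x) ;; normalize (Tmp q)"
| "compute q (Neg f) = compute q f ;; Cond (Tmp q) (Flag (Tmp q) False) (Flag (Tmp q) True)"
| "compute q (Conj f g) = compute q f ;; Cond (Tmp q) (compute q g) Skip"
| "compute q (Forall f) =
     Flag (Tmp q) True ;;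
     Loop (Var (Bound q)) (Var Order)
       (compute (Suc q) f ;; Cond (Tmp (Suc q)) Skip (Flag (Tmp q) False))"

definition scratch :: "nat \<Rightarrow> loc set" where
  "scratch q = range Tmp \<union> Var ` Bound ` {q..}"

lemma scratch_iff [simp]:
  "Tmp j \<in> scratch q" "Var x \<in> scratch q \<longleftrightarrow> \<not> in_scope q x" "Arr a i \<notin> scratch q"
  by (auto simp: scratch_def in_scope_def)

lemma scratch_Suc: "scratch q = insert (Var (Bound q)) (scratch (Suc q))"
proof -
  have "{q..} = insert q {Suc q..}" by auto
  then show ?thesis by (simp add: scratch_def)
qed

lemma in_scope_simps [simp]:
  "in_scope q (Bound j) \<longleftrightarrow> j < q"
  "in_scope q Answer" "in_scope q Order" "in_scope q Last" "in_scope q Target"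
  "in_scope q Weight" "in_scope q Best" "in_scope q Size" "in_scope q Nbhd_Size"
  "in_scope q Finished" "in_scope q Round" "in_scope q Pivot" "in_scope q Vertex"
  by (simp_all add: in_scope_def)

lemma mods_compute: "mods (compute q f) \<subseteq> Tmp ` {q..} \<union> Var ` Bound ` {q..}"
proof (induction f arbitrary: q)
  case (Forall f)
  have "Tmp ` {Suc q..} \<union> Var ` Bound ` {Suc q..} \<subseteq> Tmp ` {q..} \<union> Var ` Bound ` {q..}" by auto
  then show ?case using Forall[of "Suc q"] by auto
qed (auto simp: normalize_def)

lemma agree_except_compute: "agree_except (scratch q) s (sem w N (compute q f) s)"
  using mods_compute[of q f]
  by (intro agree_except_mono[OF agree_except_mods]) (auto simp: scratch_def)

lemma sem_compute_frame [simp]: "l \<notin> scratch q \<Longrightarrow> sem w N (compute q f) s l = s l"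
  using agree_except_compute by (rule agree_exceptD)

lemma agree_except_bind:
  "agree_except (scratch q) s t \<Longrightarrow>
   agree_except (scratch (Suc q)) (s(Var (Bound q) := i)) (t(Var (Bound q) := i))"
  by (auto simp: agree_except_def scratch_Suc[of q])

lemma holds_cong:
  assumes "wf_fm q f" "agree_except (scratch q) s t"
  shows "holds w N q f t \<longleftrightarrow> holds w N q f s"
  using assms
proof (induction f arbitrary: q s t)
  case (Conj f g)
  from Conj.IH(1)[of q s t] Conj.IH(2)[of q s t] Conj.prems show ?case by simp
next
  case (Forall f)
  have "holds w N (Suc q) f (t(Var (Bound q) := i)) \<longleftrightarrow>
      holds w N (Suc q) f (s(Var (Bound q) := i))" for i
    using Forall.prems by (intro Forall.IH agree_except_bind) simp_all
  moreover have "t (Var Order) = s (Var Order)" using Forall.prems(2) by (rule agree_exceptD) simp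
  ultimately show ?case by simp
qed (auto simp: agree_except_def)

lemma compute_Symbol_correct:
  assumes "1 \<le> N"
  shows "sem w N (compute q (Symbol b x y)) s (Tmp q) = of_bool (holds w N q (Symbol b x y) s)"
proof -
  let ?c = "Plus (Tmp q) (Tmp q) (Var Order)"
  let ?s = "s(Tmp q := 1)"
  let ?t = "sem w N (Loop (Tmp (Suc q)) (Var x) ?c) ?s"
  have "?t (Tmp q) = min N (1 + ?s (Var x) * s (Var Order))"
  proof (rule sem_Loop_invariant[where I = "\<lambda>i t. t (Tmp q) = min N (1 + i * s (Var Order))"])
    fix i t
    assume "t (Tmp q) = min N (1 + i * s (Var Order))"
      and "agree_except (insert (Tmp (Suc q)) (mods ?c)) ?s t"
    moreover from this(2) have "t (Var Order) = s (Var Order)"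
      by (simp add: agree_except_def)
    ultimately show "sem w N ?c (t(Tmp (Suc q) := i)) (Tmp q) = min N (1 + Suc i * s (Var Order))"
      by (simp add: min_def)
  qed (use assms in simp)
  moreover have "?t (Var z) = s (Var z)" for z by (simp add: sem_frame)
  ultimately show ?thesis
    using assms by (simp add: cell_pos_def) (simp add: min_def algebra_simps)
qed

lemma compute_correct:
  assumes "wf_fm q f" "1 \<le> N"
  shows "sem w N (compute q f) s (Tmp q) = of_bool (holds w N q f s)"
  using assms
proof (induction f arbitrary: q s)
  case (Symbol b x y)
  then show ?case by (intro compute_Symbol_correct)
next
  case (Conj f g)
  then show ?case by (simp add: holds_cong[OF _ agree_except_compute])
next
  case (Forall f)
  let ?c = "compute (Suc q) f ;; Cond (Tmp (Suc q)) Skip (Flag (Tmp q) False)"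
  let ?s = "s(Tmp q := 1)"
  let ?I = "\<lambda>i t. t (Tmp q) = of_bool (\<forall>j<i. holds w N (Suc q) f (s(Var (Bound q) := j)))"
  have "?I (?s (Var Order)) (sem w N (Loop (Var (Bound q)) (Var Order) ?c) ?s)"
  proof (rule sem_Loop_invariant[where I = ?I])
    fix i t
    assume t: "?I i t" and agree: "agree_except (insert (Var (Bound q)) (mods ?c)) ?s t"
    let ?t = "t(Var (Bound q) := i)"
    have Tmp_q: "sem w N (compute (Suc q) f) ?t (Tmp q) = t (Tmp q)"
      using mods_compute[of "Suc q" f] by (subst sem_frame) auto
    have "insert (Var (Bound q)) (mods ?c) \<subseteq> scratch q"
      using mods_compute[of "Suc q" f] by (auto simp: scratch_def)
    then have "agree_except (scratch q) ?s t" using agree by (rule agree_except_mono[rotated])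
    then have "agree_except (scratch q) s t" by (auto simp: agree_except_def)
    then have "agree_except (scratch (Suc q)) (s(Var (Bound q) := i)) ?t"
      by (rule agree_except_bind)
    moreover have "wf_fm (Suc q) f" using Forall.prems by simp
    ultimately have "sem w N (compute (Suc q) f) ?t (Tmp (Suc q)) =
        of_bool (holds w N (Suc q) f (s(Var (Bound q) := i)))"
      using Forall by (simp add: holds_cong)
    then show "?I (Suc i) (sem w N ?c ?t)"
      using t Tmp_q by (auto simp: less_Suc_eq)
  qed simp
  then show ?case by simp
qed (simp_all add: normalize_def)


section \<open>Commands driven by formulas\<close>

definition test :: "fm \<Rightarrow> com \<Rightarrow> com \<Rightarrow> com" where
  "test f c1 c2 = compute 0 f ;; Cond (Tmp 0) c1 c2"

definition decide :: "var \<Rightarrow> fm \<Rightarrow> com" where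
  "decide x f = test f (Flag (Var x) True) (Flag (Var x) False)"

definition copy :: "var \<Rightarrow> var \<Rightarrow> com" where
  "copy x y = Flag (Tmp 0) False ;; Plus (Var x) (Var y) (Tmp 0)"

definition incr :: "var \<Rightarrow> com" where
  "incr x = Flag (Tmp 0) True ;; Plus (Var x) (Var x) (Tmp 0)"

definition maximize :: "var \<Rightarrow> var \<Rightarrow> com" where
  "maximize x y = Minus (Tmp 0) (Var y) (Var x) ;; Plus (Var x) (Var x) (Tmp 0)"

definition fill :: "array \<Rightarrow> fm \<Rightarrow> com" where
  "fill a f = Loop (Var Vertex) (Var Order) (compute 0 f ;; Put a (Var Vertex) (Tmp 0))"

definition tally :: "var \<Rightarrow> fm \<Rightarrow> com" where
  "tally x f = Loop (Var Vertex) (Var Order) (test f (incr x) Skip)"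

lemma mods_commands [simp]:
  assumes "l \<notin> scratch 0"
  shows "l \<in> mods (test f c1 c2) \<longleftrightarrow> l \<in> mods c1 \<or> l \<in> mods c2"
    and "l \<in> mods (decide x f) \<longleftrightarrow> l = Var x"
    and "l \<in> mods (copy x y) \<longleftrightarrow> l = Var x"
    and "l \<in> mods (incr x) \<longleftrightarrow> l = Var x"
    and "l \<in> mods (maximize x y) \<longleftrightarrow> l = Var x"
    and "l \<in> mods (fill a f) \<longleftrightarrow> l = Var Vertex \<or> (\<exists>i. l = Arr a i)"
    and "l \<in> mods (tally x f) \<longleftrightarrow> l = Var Vertex \<or> l = Var x"
  using assms mods_compute[of 0 f]
  by (auto simp: test_def decide_def copy_def incr_def maximize_def fill_def tally_def scratch_def)

lemma sem_test:
  assumes "wf_fm 0 f" "1 \<le> N"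
  shows "sem w N (test f c1 c2) s =
    (if holds w N 0 f s then sem w N c1 (sem w N (compute 0 f) s)
     else sem w N c2 (sem w N (compute 0 f) s))"
  using compute_correct[OF assms] by (simp add: test_def)

lemma sem_decide:
  assumes "wf_fm 0 f" "1 \<le> N"
  shows "sem w N (decide x f) s (Var x) = of_bool (holds w N 0 f s)"
  using assms by (simp add: decide_def sem_test)

lemma sem_copy: "s (Var y) \<le> N \<Longrightarrow> sem w N (copy x y) s = s(Tmp 0 := 0, Var x := s (Var y))"
  by (simp add: copy_def)

lemma sem_incr:
  "s (Var x) < N \<Longrightarrow> sem w N (incr x) s = s(Tmp 0 := 1, Var x := Suc (s (Var x)))"
  by (simp add: incr_def)

lemma sem_maximize:
  assumes "s (Var x) \<le> N" "s (Var y) \<le> N" "x \<noteq> y"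
  shows "sem w N (maximize x y) s =
    s(Tmp 0 := s (Var y) - s (Var x), Var x := max (s (Var x)) (s (Var y)))"
  using assms by (simp add: maximize_def max_def)

text \<open>
  The formula may refer to the array that is being filled, as long as its value at a vertex does
  not depend on the entries of smaller vertices.
\<close>

lemma sem_fill:
  assumes f: "wf_fm 0 f" and N: "1 \<le> N" and i: "i < s (Var Order)"
    and Q: "\<And>j t. j < s (Var Order) \<Longrightarrow>
      agree_except (insert (Var Vertex) (Arr a ` {..<j} \<union> scratch 0)) s t \<Longrightarrow>
      t (Var Vertex) = j \<Longrightarrow> holds w N 0 f t \<longleftrightarrow> Q j"
  shows "sem w N (fill a f) s (Arr a i) = of_bool (Q i)"
proof -
  let ?c = "compute 0 f ;; Put a (Var Vertex) (Tmp 0)"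
  let ?agree = "\<lambda>i. agree_except (insert (Var Vertex) (Arr a ` {..<i} \<union> scratch 0)) s"
  let ?I = "\<lambda>i t. (\<forall>j<i. t (Arr a j) = of_bool (Q j)) \<and> ?agree i t"
  have "?I (s (Var Order)) (sem w N (fill a f) s)"
    unfolding fill_def
  proof (rule sem_Loop_invariant[where I = ?I])
    fix i t assume i: "i < s (Var Order)" and t: "?I i t"
    let ?t = "t(Var Vertex := i)"
    have "?agree i ?t" using t by (simp add: agree_except_def)
    then have "sem w N (compute 0 f) ?t (Tmp 0) = of_bool (Q i)"
      using Q[OF i] compute_correct[OF f N] by simp
    then have "sem w N ?c ?t = (sem w N (compute 0 f) ?t)(Arr a i := of_bool (Q i))" by simp
    then show "?I (Suc i) (sem w N ?c ?t)"
      using t by (auto simp: agree_except_def lessThan_Suc less_Suc_eq)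
  qed simp
  then show ?thesis using i by blast
qed

lemma sem_tally:
  assumes f: "wf_fm 0 f" and N: "1 \<le> N" and x: "x \<notin> {Vertex, Order}" "in_scope 0 x"
    and Q: "\<And>j t. j < s (Var Order) \<Longrightarrow>
      agree_except ({Var Vertex, Var x} \<union> scratch 0) s t \<Longrightarrow>
      t (Var Vertex) = j \<Longrightarrow> holds w N 0 f t \<longleftrightarrow> Q j"
    and le: "s (Var x) + card {j. j < s (Var Order) \<and> Q j} \<le> N"
  shows "sem w N (tally x f) s (Var x) = s (Var x) + card {j. j < s (Var Order) \<and> Q j}"
proof -
  let ?c = "test f (incr x) Skip"
  let ?sum = "\<lambda>i. \<Sum>j<i. of_bool (Q j) :: nat"
  let ?I = "\<lambda>i t. t (Var x) = s (Var x) + ?sum i"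
  have sum: "?sum (s (Var Order)) = card {j. j < s (Var Order) \<and> Q j}"
    by (simp add: Collect_conj_eq lessThan_def)
  have "?I (s (Var Order)) (sem w N (tally x f) s)"
    unfolding tally_def
  proof (rule sem_Loop_invariant[where I = ?I])
    fix i t
    assume i: "i < s (Var Order)" and t: "?I i t"
      and agree: "agree_except (insert (Var Vertex) (mods ?c)) s t"
    let ?t = "t(Var Vertex := i)"
    have "agree_except ({Var Vertex, Var x} \<union> scratch 0) s ?t"
      using agree by (simp add: agree_except_def)
    then have Qi: "holds w N 0 f ?t \<longleftrightarrow> Q i" using Q[OF i] by simp
    have "?sum (Suc i) \<le> ?sum (s (Var Order))" using i by (intro sum_mono2) auto
    then have "s (Var x) + ?sum (Suc i) \<le> N" using le sum by simp
    then show "?I (Suc i) (sem w N ?c ?t)"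
      using Qi t x by (cases "Q i") (simp_all add: sem_test[OF f N] sem_incr)
  qed simp
  then show ?thesis by (simp only: sum)
qed


section \<open>The algorithm\<close>

definition edge_fm :: "var \<Rightarrow> var \<Rightarrow> fm" where "edge_fm x y = Symbol 1 x y"
definition modulator_fm :: "var \<Rightarrow> fm" where "modulator_fm x = Symbol 1 Order x"
definition digit_fm :: "var \<Rightarrow> fm" where "digit_fm x = Symbol 1 Last x"

primrec solution_fm :: "problem \<Rightarrow> var \<Rightarrow> var \<Rightarrow> fm" where
  "solution_fm Independent_Set x y = Neg (edge_fm x y)"
| "solution_fm Clique x y = edge_fm x y"

definition pairwise_fm :: "problem \<Rightarrow> fm" where
  "pairwise_fm pr = Forall (Forall
     (Imp (Conj (Mem Chosen (Bound 0)) (Conj (Mem Chosen (Bound 1)) (Neq (Bound 0) (Bound 1))))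
       (solution_fm pr (Bound 0) (Bound 1))))"

definition extender_fm :: "problem \<Rightarrow> fm" where
  "extender_fm pr = Conj (Neg (modulator_fm Vertex))
     (Forall (Imp (Mem Chosen (Bound 0)) (solution_fm pr Vertex (Bound 0))))"

definition nbhd_fm :: "var \<Rightarrow> fm" where
  "nbhd_fm x = Conj (Mem Candidates x) (Imp (Neq Pivot x) (edge_fm Pivot x))"

definition simplicial_fm :: fm where
  "simplicial_fm = Conj (Mem Candidates Pivot) (Forall (Forall
     (Imp (Conj (nbhd_fm (Bound 0)) (Conj (nbhd_fm (Bound 1)) (Neq (Bound 0) (Bound 1))))
       (edge_fm (Bound 0) (Bound 1)))))"

definition full_fm :: fm where
  "full_fm = Forall (Imp (modulator_fm (Bound 0)) (Mem Chosen (Bound 0)))"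

definition successor_fm :: fm where
  "successor_fm = Conj (modulator_fm Vertex) (Iff (Neg (Mem Chosen Vertex))
     (Forall (Imp (Conj (modulator_fm (Bound 0)) (Less (Bound 0) Vertex))
       (Mem Chosen (Bound 0)))))"

text \<open>
  The end marker occurs at digit \<open>Suc n\<close> of p if and only if \<open>p < 2 ^ Suc n\<close>. This excludes
  larger p, of which \<open>Target\<close> only represents the lower digits.
\<close>

definition reached_fm :: fm where
  "reached_fm = Conj (Symbol 2 Last Last) (Neg (Less Best Target))"

definition retain :: "fm \<Rightarrow> com" where
  "retain f = fill Candidates (Conj (Mem Candidates Vertex) f)"

primrec eliminate :: "problem \<Rightarrow> com" where
  "eliminate Independent_Set = incr Size ;; retain (Neg (nbhd_fm Vertex))"
| "eliminate Clique =
     copy Nbhd_Size Size ;; tally Nbhd_Size (nbhd_fm Vertex) ;; maximize Best Nbhd_Size ;;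
     retain (Neq Pivot Vertex)"

definition sweep :: "problem \<Rightarrow> com" where
  "sweep pr = Loop (Var Pivot) (Var Order) (test simplicial_fm (eliminate pr) Skip)"

definition eliminate_all :: "problem \<Rightarrow> com" where
  "eliminate_all pr = Loop (Var Round) (Var Order) (sweep pr)"

definition init_branch :: "problem \<Rightarrow> com" where
  "init_branch pr = Flag (Var Size) False ;; tally Size (Mem Chosen Vertex) ;;
     fill Candidates (extender_fm pr)"

definition branch :: "problem \<Rightarrow> com" where
  "branch pr = test (pairwise_fm pr)
     (init_branch pr ;; eliminate_all pr ;; maximize Best Size) Skip"

definition next_subset :: com where
  "next_subset = decide Finished full_fm ;;
     fill Candidates successor_fm ;; fill Chosen (Mem Candidates Vertex)"

definition read_target :: com where
  "read_target = copy Last Order ;; incr Last ;;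
     Flag (Var Target) False ;; Flag (Var Weight) True ;;
     Loop (Var Vertex) (Var Last)
       (test (digit_fm Vertex) (Plus (Var Target) (Var Target) (Var Weight)) Skip ;;
        Plus (Var Weight) (Var Weight) (Var Weight))"

definition search_program :: "problem \<Rightarrow> instr list" where
  "search_program pr = complete_program read_target (branch pr ;; next_subset) (Var Finished)
     (decide Answer reached_fm)"

lemma wf_fm_simps [simp]:
  "wf_fm q (edge_fm x y) \<longleftrightarrow> in_scope q x \<and> in_scope q y"
  "wf_fm q (modulator_fm x) \<longleftrightarrow> in_scope q x"
  "wf_fm q (digit_fm x) \<longleftrightarrow> in_scope q x"
  "wf_fm q (solution_fm pr x y) \<longleftrightarrow> in_scope q x \<and> in_scope q y"
  "wf_fm q (nbhd_fm x) \<longleftrightarrow> in_scope q x"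
  "wf_fm 0 (pairwise_fm pr)" "wf_fm 0 (extender_fm pr)" "wf_fm 0 simplicial_fm"
  "wf_fm 0 full_fm" "wf_fm 0 successor_fm" "wf_fm 0 reached_fm"
  by (cases pr; auto simp: edge_fm_def modulator_fm_def digit_fm_def nbhd_fm_def
      pairwise_fm_def extender_fm_def simplicial_fm_def full_fm_def successor_fm_def
      reached_fm_def)+

lemma notin_mods_eliminate [simp]:
  "l \<notin> scratch 0 \<union> Var ` {Size, Nbhd_Size, Best, Vertex} \<Longrightarrow> (\<And>i. l \<noteq> Arr Candidates i) \<Longrightarrow>
    l \<notin> mods (eliminate pr)"
  by (cases pr) (auto simp: retain_def)

lemma notin_mods_sweep [simp]:
  "l \<notin> scratch 0 \<union> Var ` {Size, Nbhd_Size, Best, Vertex, Pivot} \<Longrightarrow> (\<And>i. l \<noteq> Arr Candidates i) \<Longrightarrow>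
    l \<notin> mods (sweep pr)"
  by (simp add: sweep_def)

lemma notin_mods_branch [simp]:
  "l \<notin> scratch 0 \<union> Var ` {Size, Nbhd_Size, Best, Vertex, Pivot, Round} \<Longrightarrow>
    (\<And>i. l \<noteq> Arr Candidates i) \<Longrightarrow>
    l \<notin> mods (branch pr)"
  by (auto simp: branch_def init_branch_def eliminate_all_def)

locale graph_input =
  fixes w :: "bool list" and n :: nat and E :: "nat \<Rightarrow> nat \<Rightarrow> bool" and X :: "nat set" and p :: nat
  assumes input_unary: "i \<le> n \<Longrightarrow> input_symbol w i = of_bool (i < n)"
    and input_edge: "i < n \<Longrightarrow> j < n \<Longrightarrow> input_symbol w (cell_pos n i j) = of_bool (E i j)"
    and input_modulator: "j < n \<Longrightarrow> input_symbol w (cell_pos n n j) = of_bool (j \<in> X)"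
    and input_target: "input_symbol w (cell_pos n (Suc n) j) =
      (if p < 2 ^ j then 2 else of_bool (bit p j))"
    and sym: "symp E" and modulator: "X \<subseteq> {..<n}"
    and simplicial_rest: "hereditarily_simplicial E ({..<n} - X)"
begin

abbreviation exec :: "com \<Rightarrow> store \<Rightarrow> store" where "exec \<equiv> sem w (cap n)"
abbreviation sat :: "nat \<Rightarrow> fm \<Rightarrow> store \<Rightarrow> bool" where "sat \<equiv> holds w (cap n)"

definition members :: "array \<Rightarrow> store \<Rightarrow> nat set" where
  "members a s = {j. j < n \<and> s (Arr a j) \<noteq> 0}"

lemma finite_members [simp]: "finite (members a s)"
  by (simp add: members_def)

lemma members_subset: "members a s \<subseteq> {..<n}"
  by (auto simp: members_def)

lemma card_members_le: "card (members a s) \<le> n"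
  using card_mono[OF finite_lessThan members_subset] by simp

lemma members_upd [simp]:
  "members a (s(Var x := i)) = members a s" "members a (s(Tmp j := i)) = members a s"
  by (simp_all add: members_def)

lemma members_agree:
  assumes "agree_except L s t" "L \<inter> range (Arr a) = {}"
  shows "members a t = members a s"
  using assms unfolding members_def agree_except_def by (metis disjoint_iff rangeI)

lemma finite_modulator: "finite X"
  using modulator by (rule finite_subset) simp

lemma cell_pos_le_cap: "i \<le> Suc n \<Longrightarrow> j \<le> Suc n \<Longrightarrow> cell_pos n i j \<le> cap n"
  using mult_le_mono1[of i "Suc n" n] by (simp add: cell_pos_def cap_def)

lemma sat_edge_fm [simp]:
  "s (Var Order) = n \<Longrightarrow> s (Var x) < n \<Longrightarrow> s (Var y) < n \<Longrightarrow>
    sat q (edge_fm x y) s \<longleftrightarrow> E (s (Var x)) (s (Var y))"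
  by (simp add: edge_fm_def min_absorb2 cell_pos_le_cap input_edge)

lemma sat_modulator_fm [simp]:
  "s (Var Order) = n \<Longrightarrow> s (Var x) < n \<Longrightarrow> sat q (modulator_fm x) s \<longleftrightarrow> s (Var x) \<in> X"
  by (simp add: modulator_fm_def min_absorb2 cell_pos_le_cap input_modulator)

lemma sat_solution_fm [simp]:
  "s (Var Order) = n \<Longrightarrow> s (Var x) < n \<Longrightarrow> s (Var y) < n \<Longrightarrow>
    sat q (solution_fm pr x y) s \<longleftrightarrow> solution_rel pr E (s (Var x)) (s (Var y))"
  by (cases pr) simp_all

lemma less_if_members: "j \<in> members a s \<Longrightarrow> j < n"
  using members_subset by blast

lemma sat_Mem: "s (Var x) < n \<Longrightarrow> sat q (Mem a x) s \<longleftrightarrow> s (Var x) \<in> members a s"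
  by (simp add: members_def)

declare holds_Mem [simp del] sat_Mem [simp]

lemma sat_pairwise_fm:
  "s (Var Order) = n \<Longrightarrow>
    sat 0 (pairwise_fm pr) s \<longleftrightarrow> pairwise (solution_rel pr E) (members Chosen s)"
  using less_if_members[of _ Chosen s] by (auto simp: pairwise_fm_def pairwise_def)

lemma sat_extender_fm:
  "s (Var Order) = n \<Longrightarrow> s (Var Vertex) < n \<Longrightarrow> sat 0 (extender_fm pr) s \<longleftrightarrow>
    s (Var Vertex) \<in> extenders (solution_rel pr E) ({..<n} - X) (members Chosen s)"
  using less_if_members[of _ Chosen s] by (auto simp: extender_fm_def extenders_def)

lemma sat_nbhd_fm:
  "s (Var Order) = n \<Longrightarrow> s (Var Pivot) < n \<Longrightarrow> s (Var x) < n \<Longrightarrow> sat q (nbhd_fm x) s \<longleftrightarrow>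
    s (Var x) \<in> closed_nbhd E (members Candidates s) (s (Var Pivot))"
  by (auto simp: nbhd_fm_def closed_nbhd_def)

lemma sat_simplicial_fm:
  assumes "s (Var Order) = n" "s (Var Pivot) < n"
  shows "sat 0 simplicial_fm s \<longleftrightarrow> simplicial E (members Candidates s) (s (Var Pivot))"
proof -
  have "j < n" if "j \<in> closed_nbhd E (members Candidates s) (s (Var Pivot))" for j
    using that by (auto simp: closed_nbhd_def dest: less_if_members)
  then show ?thesis
    using assms by (auto simp: simplicial_fm_def simplicial_def sat_nbhd_fm pairwise_def)
qed

lemma sat_full_fm:
  "s (Var Order) = n \<Longrightarrow> sat 0 full_fm s \<longleftrightarrow> X \<subseteq> members Chosen s"
  using modulator by (auto simp: full_fm_def)

lemma sat_successor_fm: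
  "s (Var Order) = n \<Longrightarrow> s (Var Vertex) < n \<Longrightarrow>
    sat 0 successor_fm s \<longleftrightarrow> s (Var Vertex) \<in> colex_succ X (members Chosen s)"
  using modulator by (auto simp: successor_fm_def colex_succ_def)

lemma members_fill:
  assumes "wf_fm 0 f" "s (Var Order) = n"
    and "\<And>j t. j < n \<Longrightarrow> agree_except (insert (Var Vertex) (Arr a ` {..<j} \<union> scratch 0)) s t \<Longrightarrow>
      t (Var Vertex) = j \<Longrightarrow> sat 0 f t \<longleftrightarrow> j \<in> A"
  shows "members a (exec (fill a f) s) = {..<n} \<inter> A"
proof -
  have "exec (fill a f) s (Arr a i) = of_bool (i \<in> A)" if "i < n" for i
    by (rule sem_fill) (use assms that in auto)
  then show ?thesis by (auto simp: members_def)
qed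


lemma members_fill_Mem:
  assumes "s (Var Order) = n" "a \<noteq> b"
  shows "members a (exec (fill a (Mem b Vertex)) s) = members b s"
proof -
  have "members a (exec (fill a (Mem b Vertex)) s) = {..<n} \<inter> members b s"
  proof (rule members_fill)
    fix j t
    assume j: "j < n" "t (Var Vertex) = j"
      and agree: "agree_except (insert (Var Vertex) (Arr a ` {..<j} \<union> scratch 0)) s t"
    have "members b t = members b s" using agree by (rule members_agree) (use assms(2) in auto)
    then show "sat 0 (Mem b Vertex) t \<longleftrightarrow> j \<in> members b s" using j by simp
  qed (use assms(1) in simp_all)
  then show ?thesis by (auto simp: members_def)
qed

lemma exec_tally:
  assumes "wf_fm 0 f" "s (Var Order) = n" "x \<notin> {Vertex, Order}" "in_scope 0 x" "A \<subseteq> {..<n}"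
    and "\<And>j t. j < n \<Longrightarrow> agree_except ({Var Vertex, Var x} \<union> scratch 0) s t \<Longrightarrow>
      t (Var Vertex) = j \<Longrightarrow> sat 0 f t \<longleftrightarrow> j \<in> A"
    and "s (Var x) + card A \<le> cap n"
  shows "exec (tally x f) s (Var x) = s (Var x) + card A"
proof -
  have A: "{j. j < n \<and> j \<in> A} = A" using assms(5) by auto
  have "exec (tally x f) s (Var x) = s (Var x) + card {j. j < s (Var Order) \<and> j \<in> A}"
    by (rule sem_tally) (use assms in \<open>simp_all add: A\<close>)
  then show ?thesis using assms(2) by (simp add: A)
qed


section \<open>Correctness of the elimination\<close>

definition state :: "store \<Rightarrow> nat \<times> nat \<times> nat set" where
  "state s = (s (Var Best), s (Var Size), members Candidates s)"

lemma members_eq_snd_state: "members Candidates s = snd (snd (state s))"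
  by (simp add: state_def)

lemma members_retain:
  assumes s: "s (Var Order) = n" and f: "wf_fm 0 f"
    and sat: "\<And>j t. j \<in> members Candidates s \<Longrightarrow>
      agree_except (insert (Var Vertex) (Arr Candidates ` {..<j} \<union> scratch 0)) s t \<Longrightarrow>
      t (Var Vertex) = j \<Longrightarrow> sat 0 f t \<longleftrightarrow> j \<in> A"
  shows "members Candidates (exec (retain f) s) = members Candidates s \<inter> A"
proof -
  have "members Candidates (exec (retain f) s) = {..<n} \<inter> (members Candidates s \<inter> A)"
    unfolding retain_def
  proof (rule members_fill)
    fix j t
    assume j: "j < n" "t (Var Vertex) = j"
      and agree: "agree_except (insert (Var Vertex) (Arr Candidates ` {..<j} \<union> scratch 0)) s t"
    have "t (Arr Candidates j) = s (Arr Candidates j)"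
      using agree by (auto simp: agree_except_def)
    then have "j \<in> members Candidates t \<longleftrightarrow> j \<in> members Candidates s" by (simp add: members_def)
    then show "sat 0 (Conj (Mem Candidates Vertex) f) t \<longleftrightarrow> j \<in> members Candidates s \<inter> A"
      using j sat[OF _ agree] by auto
  qed (use f s in simp_all)
  then show ?thesis by (auto simp: members_def)
qed

lemma exec_eliminate_independent:
  assumes s: "s (Var Order) = n" "s (Var Pivot) < n" "s (Var Size) < n"
  shows "state (exec (eliminate Independent_Set) s) =
    eliminate_vertex Independent_Set E (s (Var Pivot)) (state s)"
proof -
  let ?A = "members Candidates s" and ?v = "s (Var Pivot)"
  define s1 where "s1 = exec (incr Size) s"
  have s1: "s1 = s(Tmp 0 := 1, Var Size := Suc (s (Var Size)))"
    unfolding s1_def using s(3) Suc_less_cap[of n] by (intro sem_incr) simp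
  have "members Candidates (exec (retain (Neg (nbhd_fm Vertex))) s1) =
      members Candidates s1 \<inter> - closed_nbhd E ?A ?v"
  proof (rule members_retain)
    fix j t
    assume j: "j \<in> members Candidates s1" "t (Var Vertex) = j"
      and agree: "agree_except (insert (Var Vertex) (Arr Candidates ` {..<j} \<union> scratch 0)) s1 t"
    have t: "t (Var Order) = n" "t (Var Pivot) = ?v" "t (Arr Candidates j) = s (Arr Candidates j)"
      using agree s by (auto simp: agree_except_def s1)
    have "j \<in> members Candidates t \<longleftrightarrow> j \<in> ?A" using t(3) by (simp add: members_def)
    then show "sat 0 (Neg (nbhd_fm Vertex)) t \<longleftrightarrow> j \<in> - closed_nbhd E ?A ?v"
      using j t s less_if_members[OF j(1)] by (simp add: sat_nbhd_fm closed_nbhd_def)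
  qed (use s in \<open>simp_all add: s1\<close>)
  also have "\<dots> = ?A - closed_nbhd E ?A ?v" by (auto simp: s1)
  finally show ?thesis
    by (simp add: state_def sem_frame retain_def flip: s1_def) (simp add: s1)
qed

lemma exec_tally_nbhd:
  assumes s: "s (Var Order) = n" "s (Var Pivot) < n"
    and le: "s (Var Size) + card (closed_nbhd E (members Candidates s) (s (Var Pivot))) \<le> n"
  shows "exec (copy Nbhd_Size Size ;; tally Nbhd_Size (nbhd_fm Vertex)) s (Var Nbhd_Size) =
    s (Var Size) + card (closed_nbhd E (members Candidates s) (s (Var Pivot)))"
proof -
  let ?N = "closed_nbhd E (members Candidates s) (s (Var Pivot))"
  define s1 where "s1 = exec (copy Nbhd_Size Size) s"
  have s1: "s1 = s(Tmp 0 := 0, Var Nbhd_Size := s (Var Size))"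
    unfolding s1_def using le Suc_less_cap[of n] by (intro sem_copy) simp
  have "exec (tally Nbhd_Size (nbhd_fm Vertex)) s1 (Var Nbhd_Size) =
      s1 (Var Nbhd_Size) + card ?N"
  proof (rule exec_tally)
    fix j t
    assume j: "j < n" "t (Var Vertex) = j"
      and agree: "agree_except ({Var Vertex, Var Nbhd_Size} \<union> scratch 0) s1 t"
    have "members Candidates t = members Candidates s1"
      using agree by (rule members_agree) auto
    moreover have "t (Var Order) = n" "t (Var Pivot) = s (Var Pivot)"
      using agree s by (auto simp: agree_except_def s1)
    ultimately show "sat 0 (nbhd_fm Vertex) t \<longleftrightarrow> j \<in> ?N"
      using j s by (simp add: sat_nbhd_fm s1)
  next
    show "?N \<subseteq> {..<n}" using closed_nbhd_subset members_subset by (rule order_trans)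
  qed (use s le Suc_less_cap[of n] in \<open>simp_all add: s1\<close>)
  then show ?thesis by (simp add: s1 flip: s1_def)
qed

lemma exec_eliminate_clique:
  assumes s: "s (Var Order) = n" "s (Var Pivot) < n"
    and le: "s (Var Best) \<le> n"
      "s (Var Size) + card (closed_nbhd E (members Candidates s) (s (Var Pivot))) \<le> n"
  shows "state (exec (eliminate Clique) s) =
    eliminate_vertex Clique E (s (Var Pivot)) (state s)"
proof -
  let ?v = "s (Var Pivot)"
  let ?N = "closed_nbhd E (members Candidates s) ?v"
  define s1 where "s1 = exec (copy Nbhd_Size Size ;; tally Nbhd_Size (nbhd_fm Vertex)) s"
  define s2 where "s2 = exec (maximize Best Nbhd_Size) s1"
  have s1: "s1 l = s l" if "l \<notin> scratch 0" "l \<noteq> Var Vertex" "l \<noteq> Var Nbhd_Size" for l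
    unfolding s1_def using that by (intro sem_frame) simp
  have "s1 (Var Nbhd_Size) = s (Var Size) + card ?N"
    unfolding s1_def by (rule exec_tally_nbhd[OF s le(2)])
  then have s2: "s2 = s1(Tmp 0 := s1 (Var Nbhd_Size) - s1 (Var Best),
      Var Best := max (s (Var Best)) (s (Var Size) + card ?N))"
    unfolding s2_def using le s1 Suc_less_cap[of n] by (subst sem_maximize) simp_all
  have candidates: "members Candidates s2 = members Candidates s"
    by (simp add: s2 members_def s1)
  have "members Candidates (exec (retain (Neq Pivot Vertex)) s2) = members Candidates s2 \<inter> - {?v}"
  proof (rule members_retain)
    fix j t
    assume j: "t (Var Vertex) = j"
      and agree: "agree_except (insert (Var Vertex) (Arr Candidates ` {..<j} \<union> scratch 0)) s2 t"
    have "t (Var Pivot) = ?v" using agree by (auto simp: agree_except_def s2 s1)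
    then show "sat 0 (Neq Pivot Vertex) t \<longleftrightarrow> j \<in> - {?v}" using j by auto
  qed (use s in \<open>simp_all add: s2 s1\<close>)
  moreover have "exec (eliminate Clique) s = exec (retain (Neq Pivot Vertex)) s2"
    by (simp add: s1_def s2_def)
  ultimately show ?thesis
    by (simp add: state_def sem_frame retain_def candidates Diff_eq) (simp add: s2 s1)
qed

lemma exec_eliminate:
  assumes s: "s (Var Order) = n"
    and v: "simplicial E (members Candidates s) (s (Var Pivot))"
    and le: "attainable (solution_rel pr E) (state s) \<le> n"
  shows "state (exec (eliminate pr) s) = eliminate_vertex pr E (s (Var Pivot)) (state s)"
proof (cases pr)
  case Independent_Set
  moreover have "s (Var Size) < n"
    using le max_pairwise_simplicial_independent[OF finite_members sym v] Independent_Set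
    by (simp add: state_def)
  ultimately show ?thesis
    using s v exec_eliminate_independent by (simp add: simplicial_def members_def)
next
  case Clique
  moreover have "s (Var Best) \<le> n"
    "s (Var Size) + card (closed_nbhd E (members Candidates s) (s (Var Pivot))) \<le> n"
    using le max_pairwise_simplicial_clique[OF finite_members v] Clique
    by (simp_all add: state_def nat_add_max_right)
  ultimately show ?thesis
    using s v exec_eliminate_clique by (simp add: simplicial_def members_def)
qed

lemma state_exec_test_simplicial:
  assumes s: "s (Var Order) = n" "s (Var Pivot) < n"
    and le: "attainable (solution_rel pr E) (state s) \<le> n"
  shows "state (exec (test simplicial_fm (eliminate pr) Skip) s) =
    (if simplicial E (members Candidates s) (s (Var Pivot))
     then eliminate_vertex pr E (s (Var Pivot)) (state s) else state s)"
proof -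
  let ?t = "exec (compute 0 simplicial_fm) s"
  have t: "state ?t = state s" "?t (Var Order) = n" "?t (Var Pivot) = s (Var Pivot)"
    using s by (simp_all add: state_def members_def)
  have "state (exec (eliminate pr) ?t) = eliminate_vertex pr E (?t (Var Pivot)) (state ?t)"
    if "simplicial E (members Candidates s) (s (Var Pivot))"
    by (rule exec_eliminate) (use that le t in \<open>simp_all add: state_def\<close>)
  then show ?thesis using s t by (simp add: sem_test sat_simplicial_fm)
qed

lemma exec_test_simplicial:
  assumes s: "s (Var Order) = n" "s (Var Pivot) < n"
    and le: "attainable (solution_rel pr E) (state s) \<le> n"
  defines "s' \<equiv> exec (test simplicial_fm (eliminate pr) Skip) s"
  shows "attainable (solution_rel pr E) (state s') = attainable (solution_rel pr E) (state s)"
    and "members Candidates s' \<subseteq> members Candidates s"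
    and "simplicial E (members Candidates s) (s (Var Pivot)) \<Longrightarrow>
      members Candidates s' \<noteq> members Candidates s"
proof -
  let ?A = "members Candidates s" and ?v = "s (Var Pivot)"
  note state = state_exec_test_simplicial[OF s le, folded s'_def]
  show "attainable (solution_rel pr E) (state s') = attainable (solution_rel pr E) (state s)"
    using state attainable_eliminate_vertex[OF finite_members sym, of Candidates s ?v]
    by (cases "simplicial E ?A ?v") (simp_all add: state_def)
  have smaller: "members Candidates s' \<subset> ?A" if "simplicial E ?A ?v"
    unfolding members_eq_snd_state[of s'] state
    using that eliminate_vertex_psubset[OF that] by (simp add: state_def)
  then show "members Candidates s' \<noteq> ?A" if "simplicial E ?A ?v" using that by blast
  show "members Candidates s' \<subseteq> ?A"
    using smaller state by (cases "simplicial E ?A ?v") (auto simp: state_def)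
qed

lemma exec_sweep:
  assumes s: "s (Var Order) = n"
    and le: "attainable (solution_rel pr E) (state s) \<le> n"
  defines "s' \<equiv> exec (sweep pr) s"
  shows "attainable (solution_rel pr E) (state s') = attainable (solution_rel pr E) (state s)"
    and "members Candidates s' \<subseteq> members Candidates s"
    and "simplicial E (members Candidates s) v \<Longrightarrow> members Candidates s' \<noteq> members Candidates s"
proof -
  let ?K = "attainable (solution_rel pr E) (state s)" and ?A = "members Candidates s"
  let ?c = "test simplicial_fm (eliminate pr) Skip"
  let ?I = "\<lambda>j t. attainable (solution_rel pr E) (state t) = ?K \<and> members Candidates t \<subseteq> ?A \<and>
    (members Candidates t = ?A \<longrightarrow> (\<forall>v<j. \<not> simplicial E ?A v))"
  have I: "?I (s (Var Order)) s'"
    unfolding s'_def sweep_def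
  proof (rule sem_Loop_invariant[where I = ?I])
    fix j t
    assume j: "j < s (Var Order)" and I: "?I j t"
      and agree: "agree_except (insert (Var Pivot) (mods ?c)) s t"
    let ?t = "t(Var Pivot := j)"
    have "t (Var Order) = s (Var Order)" using agree by (rule agree_exceptD) simp
    then have t: "?t (Var Order) = n" "?t (Var Pivot) < n" "state ?t = state t"
      using s j by (simp_all add: state_def)
    have "attainable (solution_rel pr E) (state ?t) \<le> n" using I le t(3) by simp
    note step = exec_test_simplicial[OF t(1,2) this]
    show "?I (Suc j) (exec ?c ?t)"
      using I step t(3) by (auto simp: less_Suc_eq)
  qed simp
  then show "attainable (solution_rel pr E) (state s') = ?K" "members Candidates s' \<subseteq> ?A" by auto
  show "members Candidates s' \<noteq> ?A" if "simplicial E ?A v"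
    using that I s by (auto simp: simplicial_def members_def)
qed

lemma exec_eliminate_all:
  assumes s: "s (Var Order) = n" and le: "attainable (solution_rel pr E) (state s) \<le> n"
    and A: "members Candidates s \<subseteq> {..<n} - X"
  shows "attainable (solution_rel pr E) (state (exec (eliminate_all pr) s)) =
      attainable (solution_rel pr E) (state s)"
    and "members Candidates (exec (eliminate_all pr) s) = {}"
proof -
  let ?K = "attainable (solution_rel pr E) (state s)"
  let ?I = "\<lambda>i t. attainable (solution_rel pr E) (state t) = ?K \<and>
    members Candidates t \<subseteq> {..<n} - X \<and> card (members Candidates t) \<le> n - i"
  have "?I (s (Var Order)) (exec (eliminate_all pr) s)"
    unfolding eliminate_all_def
  proof (rule sem_Loop_invariant[where I = ?I])
    fix i t
    assume i: "i < s (Var Order)" and I: "?I i t"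
      and agree: "agree_except (insert (Var Round) (mods (sweep pr))) s t"
    let ?t = "t(Var Round := i)" and ?A = "members Candidates t"
    let ?A' = "members Candidates (exec (sweep pr) ?t)"
    have "t (Var Order) = s (Var Order)" using agree by (rule agree_exceptD) simp
    then have t: "?t (Var Order) = n" "state ?t = state t" using s by (simp_all add: state_def)
    have "attainable (solution_rel pr E) (state ?t) \<le> n" using I le t(2) by simp
    note step = exec_sweep[OF t(1) this]
    have "card ?A' \<le> n - Suc i"
    proof (cases "?A = {}")
      case False
      then obtain v where "simplicial E ?A v"
        using simplicial_rest I unfolding hereditarily_simplicial_def by blast
      then have "?A' \<subset> ?A" using step(2,3) by auto
      then have "card ?A' < card ?A" by (intro psubset_card_mono) auto
      then show ?thesis using I by linarith
    qed (use step(2) in simp)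
    then show "?I (Suc i) (exec (sweep pr) ?t)" using step I t(2) by auto
  qed (use A card_members_le in simp)
  then show "attainable (solution_rel pr E) (state (exec (eliminate_all pr) s)) = ?K"
    "members Candidates (exec (eliminate_all pr) s) = {}"
    using s by simp_all
qed

end

context graph_input
begin


section \<open>Correctness of the branching\<close>

lemma exec_init_branch:
  assumes s: "s (Var Order) = n"
  shows "state (exec (init_branch pr) s) = (s (Var Best), card (members Chosen s),
    extenders (solution_rel pr E) ({..<n} - X) (members Chosen s))"
proof -
  let ?Y = "members Chosen s"
  let ?ext = "extenders (solution_rel pr E) ({..<n} - X) ?Y"
  define s1 where "s1 = s(Var Size := 0)"
  define s2 where "s2 = exec (tally Size (Mem Chosen Vertex)) s1"
  have "s2 (Var Size) = s1 (Var Size) + card ?Y"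
    unfolding s2_def
  proof (rule exec_tally)
    fix j t
    assume j: "j < n" "t (Var Vertex) = j"
      and agree: "agree_except ({Var Vertex, Var Size} \<union> scratch 0) s1 t"
    have "members Chosen t = members Chosen s1" using agree by (rule members_agree) auto
    then show "sat 0 (Mem Chosen Vertex) t \<longleftrightarrow> j \<in> ?Y" using j by (simp add: s1_def)
  next
    show "s1 (Var Size) + card ?Y \<le> cap n"
      using card_members_le[of Chosen s] Suc_less_cap[of n] by (simp add: s1_def)
  qed (use s in \<open>simp_all add: s1_def members_subset\<close>)
  then have size: "s2 (Var Size) = card ?Y" by (simp add: s1_def)
  have s2: "s2 l = s l" if "l \<notin> scratch 0" "l \<noteq> Var Vertex" "l \<noteq> Var Size" for l
    unfolding s2_def using that by (simp add: sem_frame s1_def)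
  have "members Candidates (exec (fill Candidates (extender_fm pr)) s2) = {..<n} \<inter> ?ext"
  proof (rule members_fill)
    fix j t
    assume j: "j < n" "t (Var Vertex) = j"
      and agree: "agree_except (insert (Var Vertex) (Arr Candidates ` {..<j} \<union> scratch 0)) s2 t"
    have "members Chosen t = members Chosen s2" using agree by (rule members_agree) auto
    moreover have "\<dots> = ?Y" by (simp add: members_def s2)
    moreover have "t (Var Order) = n" using agree s by (auto simp: agree_except_def s2)
    ultimately show "sat 0 (extender_fm pr) t \<longleftrightarrow> j \<in> ?ext" using j by (simp add: sat_extender_fm)
  qed (use s in \<open>simp_all add: s2\<close>)
  also have "\<dots> = ?ext" by (auto simp: extenders_def)
  finally show ?thesis
    by (simp add: state_def init_branch_def sem_frame size s2 flip: s1_def s2_def)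
qed

lemma branch_value_le:
  assumes "Y \<subseteq> X"
  shows "branch_value (solution_rel pr E) ({..<n} - X) Y \<le> n"
proof -
  have "branch_value (solution_rel pr E) ({..<n} - X) Y \<le>
      max_pairwise (solution_rel pr E) {..<n}"
    using modulator assms sym
    by (intro branch_value_le_max_pairwise) (simp_all add: symp_solution_rel)
  also have "\<dots> \<le> n" using max_pairwise_le_card[of "{..<n}"] by simp
  finally show ?thesis .
qed

lemma exec_branch:
  assumes s: "s (Var Order) = n" "s (Var Best) \<le> n" and Y: "members Chosen s \<subseteq> X"
  shows "exec (branch pr) s (Var Best) =
    max (s (Var Best)) (branch_value (solution_rel pr E) ({..<n} - X) (members Chosen s))"
proof (cases "pairwise (solution_rel pr E) (members Chosen s)")
  case False
  then have "exec (branch pr) s = exec (compute 0 (pairwise_fm pr)) s"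
    using s by (simp add: branch_def sem_test sat_pairwise_fm)
  then show ?thesis using False by (simp add: branch_value_def)
next
  case True
  let ?Y = "members Chosen s"
  let ?ext = "extenders (solution_rel pr E) ({..<n} - X) ?Y"
  define t where "t = exec (compute 0 (pairwise_fm pr)) s"
  define u where "u = exec (init_branch pr) t"
  define v where "v = exec (eliminate_all pr) u"
  have t: "t (Var Order) = n" "t (Var Best) = s (Var Best)" "members Chosen t = ?Y"
    using s by (simp_all add: t_def members_def)
  have u: "u (Var Order) = n" "state u = (s (Var Best), card ?Y, ?ext)"
    using t exec_init_branch[of t pr] by (simp_all add: u_def sem_frame init_branch_def)
  then have optimum: "attainable (solution_rel pr E) (state u) =
      max (s (Var Best)) (branch_value (solution_rel pr E) ({..<n} - X) ?Y)"
    using True by (simp add: branch_value_def)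
  then have le: "attainable (solution_rel pr E) (state u) \<le> n"
    using s(2) branch_value_le[OF Y] by simp
  have "members Candidates u \<subseteq> {..<n} - X" using u(2) by (auto simp: state_def extenders_def)
  from exec_eliminate_all[OF u(1) le this]
  have v: "max (v (Var Best)) (v (Var Size)) = attainable (solution_rel pr E) (state u)"
    by (simp add: v_def state_def)
  then have "v (Var Best) \<le> cap n" "v (Var Size) \<le> cap n"
    using le Suc_less_cap[of n] by (simp_all add: max_def split: if_splits)
  moreover have "exec (branch pr) s = exec (maximize Best Size) v"
    using s True by (simp add: branch_def sem_test sat_pairwise_fm t_def u_def v_def)
  ultimately show ?thesis using v optimum by (simp add: sem_maximize)
qed

lemma exec_next_subset:
  assumes s: "s (Var Order) = n" and Y: "members Chosen s \<subseteq> X"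
  shows "exec next_subset s (Var Finished) = of_bool (members Chosen s = X)"
    and "members Chosen (exec next_subset s) = colex_succ X (members Chosen s)"
proof -
  let ?Y = "members Chosen s"
  define s1 where "s1 = exec (decide Finished full_fm) s"
  define s2 where "s2 = exec (fill Candidates successor_fm) s1"
  have next_subset: "exec next_subset s = exec (fill Chosen (Mem Candidates Vertex)) s2"
    by (simp add: next_subset_def s1_def s2_def)
  have s1: "s1 l = s l" if "l \<notin> scratch 0" "l \<noteq> Var Finished" for l
    unfolding s1_def using that by (simp add: sem_frame)
  then have Y1: "members Chosen s1 = ?Y" by (simp add: members_def)
  have "s1 (Var Finished) = of_bool (X \<subseteq> ?Y)"
    unfolding s1_def using s by (simp add: sem_decide sat_full_fm)
  then have "s1 (Var Finished) = of_bool (?Y = X)" using Y by auto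
  then show "exec next_subset s (Var Finished) = of_bool (?Y = X)"
    unfolding next_subset s2_def by (simp add: sem_frame)
  have "members Candidates s2 = {..<n} \<inter> colex_succ X ?Y"
    unfolding s2_def
  proof (rule members_fill)
    fix j t
    assume j: "j < n" "t (Var Vertex) = j"
      and agree: "agree_except (insert (Var Vertex) (Arr Candidates ` {..<j} \<union> scratch 0)) s1 t"
    have "members Chosen t = members Chosen s1" using agree by (rule members_agree) auto
    moreover have "t (Var Order) = n" using agree s by (auto simp: agree_except_def s1)
    ultimately show "sat 0 successor_fm t \<longleftrightarrow> j \<in> colex_succ X ?Y"
      using j Y1 by (simp add: sat_successor_fm)
  qed (use s in \<open>simp_all add: s1\<close>)
  also have "\<dots> = colex_succ X ?Y" using modulator colex_succ_subset[of X ?Y] by blast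
  finally have candidates: "members Candidates s2 = colex_succ X ?Y" .
  have "s2 (Var Order) = n" unfolding s2_def using s by (simp add: sem_frame s1)
  then show "members Chosen (exec next_subset s) = colex_succ X ?Y"
    unfolding next_subset by (simp add: members_fill_Mem candidates)
qed


section \<open>Reading the target size\<close>

lemma sat_digit_fm:
  assumes "s (Var Order) = n" "s (Var Last) = Suc n" "s (Var x) \<le> n"
  shows "sat q (digit_fm x) s \<longleftrightarrow> bit p (s (Var x))"
proof -
  have "\<not> bit p j" if "p < 2 ^ j" for j using that by (simp add: bit_iff_odd)
  then show ?thesis
    using assms by (auto simp: digit_fm_def min_absorb2 cell_pos_le_cap input_target)
qed

lemma exec_read_target:
  defines "s \<equiv> exec read_target (initial_store n)"
  shows "s (Var Order) = n" "s (Var Last) = Suc n" "s (Var Best) = 0" "members a s = {}"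
    and "s (Var Target) = min (cap n) (take_bit (Suc n) p)"
proof -
  let ?c = "test (digit_fm Vertex) (Plus (Var Target) (Var Target) (Var Weight)) Skip ;;
    Plus (Var Weight) (Var Weight) (Var Weight)"
  define s0 where "s0 = (initial_store n)(Var Last := Suc n, Tmp 0 := 1,
    Var Target := 0, Var Weight := 1)"
  let ?I = "\<lambda>i t. t (Var Target) = min (cap n) (take_bit i p) \<and>
    t (Var Weight) = min (cap n) (2 ^ i)"
  have s: "s = exec (Loop (Var Vertex) (Var Last) ?c) s0"
    using Suc_less_cap[of n]
    by (simp add: s_def read_target_def s0_def initial_store_def sem_copy sem_incr fun_upd_twist)
  have "?I (s0 (Var Last)) s"
    unfolding s
  proof (rule sem_Loop_invariant[where I = ?I])
    fix i t
    assume i: "i < s0 (Var Last)" and I: "?I i t"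
      and agree: "agree_except (insert (Var Vertex) (mods ?c)) s0 t"
    have "t (Var Order) = n" "t (Var Last) = Suc n"
      using agree by (simp_all add: agree_except_def s0_def initial_store_def)
    then have "sat 0 (digit_fm Vertex) (t(Var Vertex := i)) \<longleftrightarrow> bit p i"
      using i by (subst sat_digit_fm) (simp_all add: s0_def)
    moreover have "min (cap n) (min (cap n) a + min (cap n) b) = min (cap n) (a + b)" for a b
      by (simp add: min_def)
    ultimately show "?I (Suc i) (exec ?c (t(Var Vertex := i)))"
      using I by (simp add: sem_test take_bit_Suc_from_most mult_2 add.commute)
  qed (simp add: s0_def)
  then show "s (Var Target) = min (cap n) (take_bit (Suc n) p)" by (simp add: s0_def)
  show "s (Var Order) = n" "s (Var Last) = Suc n" "s (Var Best) = 0" "members a s = {}"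
    unfolding s members_def by (simp_all add: sem_frame s0_def initial_store_def)
qed

lemma sat_reached_fm:
  assumes s: "s (Var Order) = n" "s (Var Last) = Suc n"
      "s (Var Target) = min (cap n) (take_bit (Suc n) p)"
    and best: "s (Var Best) \<le> n"
  shows "sat 0 reached_fm s \<longleftrightarrow> p \<le> s (Var Best)"
proof (cases "p < 2 ^ Suc n")
  case True
  then have "take_bit (Suc n) p = p" by (simp add: take_bit_nat_eq_self)
  then show ?thesis
    using True s best Suc_less_cap[of n]
    by (auto simp: reached_fm_def min_absorb2 cell_pos_le_cap input_target)
next
  case False
  then have "n < p" using less_exp[of "Suc n"] by linarith
  then show ?thesis
    using False s best by (simp add: reached_fm_def min_absorb2 cell_pos_le_cap input_target)
qed


section \<open>Correctness of the search\<close>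

definition round_invariant :: "problem \<Rightarrow> nat \<Rightarrow> store \<Rightarrow> bool" where
  "round_invariant pr j s \<longleftrightarrow> s (Var Order) = n \<and> s (Var Last) = Suc n \<and>
     s (Var Target) = min (cap n) (take_bit (Suc n) p) \<and>
     members Chosen s = nth_subset X j \<and>
     s (Var Best) = best_branch (solution_rel pr E) ({..<n} - X) (nth_subset X ` {..<j})"

lemma round_invariant_Best_le:
  assumes "round_invariant pr j s"
  shows "s (Var Best) \<le> n"
proof -
  have "s (Var Best) \<le> max_pairwise (solution_rel pr E) {..<n}"
    using assms modulator sym nth_subset_subset[of X]
    by (auto simp: round_invariant_def symp_solution_rel intro!: best_branch_le_max_pairwise)
  also have "\<dots> \<le> n" using max_pairwise_le_card[of "{..<n}"] by simp
  finally show ?thesis .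
qed

lemma exec_round:
  assumes inv: "round_invariant pr j s" and j: "j < 2 ^ card X"
  defines "s' \<equiv> exec (branch pr ;; next_subset) s"
  shows "round_invariant pr (Suc j) s'"
    and "s' (Var Finished) = of_bool (Suc j = 2 ^ card X)"
proof -
  define t where "t = exec (branch pr) s"
  have s': "s' = exec next_subset t" by (simp add: s'_def t_def)
  have s: "s (Var Order) = n" "members Chosen s = nth_subset X j"
    using inv by (simp_all add: round_invariant_def)
  have t: "t (Var Order) = n" "members Chosen t = nth_subset X j"
    using s by (simp_all add: t_def sem_frame members_def)
  have Y: "nth_subset X j \<subseteq> X" by (rule nth_subset_subset)
  have kept: "s' (Var x) = s (Var x)" if "x \<in> {Order, Last, Target}" for x
    using that by (auto simp: s' t_def next_subset_def sem_frame)
  have "s' (Var Best) = t (Var Best)" by (simp add: s' next_subset_def sem_frame)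
  also have "\<dots> = max (s (Var Best))
      (branch_value (solution_rel pr E) ({..<n} - X) (nth_subset X j))"
    using exec_branch[OF s(1) round_invariant_Best_le[OF inv]] s(2) Y by (simp add: t_def)
  also have "\<dots> = best_branch (solution_rel pr E) ({..<n} - X) (nth_subset X ` {..<Suc j})"
    using inv by (simp add: round_invariant_def lessThan_Suc best_branch_insert)
  finally show "round_invariant pr (Suc j) s'"
    using inv kept exec_next_subset(2)[of t] t Y
    by (simp add: round_invariant_def nth_subset_Suc flip: s')
  show "s' (Var Finished) = of_bool (Suc j = 2 ^ card X)"
    using exec_next_subset(1)[of t] t Y nth_subset_eq_self_iff[OF finite_modulator j]
    by (simp flip: s')
qed

definition round_store :: "problem \<Rightarrow> nat \<Rightarrow> store" where
  "round_store pr j = (exec (branch pr ;; next_subset) ^^ j) (exec read_target (initial_store n))"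

lemma round_store_invariant:
  "j \<le> 2 ^ card X \<Longrightarrow> round_invariant pr j (round_store pr j)"
proof (induction j)
  case 0
  show ?case using exec_read_target by (simp add: round_invariant_def round_store_def)
next
  case (Suc j)
  then show ?case using exec_round(1)[of pr j "round_store pr j"] by (simp add: round_store_def)
qed

lemma round_store_Finished:
  assumes "0 < j" "j \<le> 2 ^ card X"
  shows "round_store pr j (Var Finished) = of_bool (j = 2 ^ card X)"
proof -
  obtain i where "j = Suc i" using assms(1) by (cases j) auto
  then show ?thesis
    using assms(2) exec_round(2)[of pr i "round_store pr i"] round_store_invariant[of i pr]
    by (simp add: round_store_def)
qed

lemma exec_decide_Answer:
  "exec (decide Answer reached_fm) (round_store pr (2 ^ card X)) (Var Answer) =
    of_bool (p \<le> max_pairwise (solution_rel pr E) {..<n})"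
proof -
  let ?s = "round_store pr (2 ^ card X)"
  have inv: "round_invariant pr (2 ^ card X) ?s" by (rule round_store_invariant) simp
  then have "?s (Var Best) = best_branch (solution_rel pr E) ({..<n} - X) (Pow X)"
    by (simp add: round_invariant_def nth_subset_image[OF finite_modulator])
  also have "\<dots> = max_pairwise (solution_rel pr E) {..<n}"
    using modulator sym by (intro best_branch_Pow) (simp_all add: symp_solution_rel)
  finally have "sat 0 reached_fm ?s \<longleftrightarrow> p \<le> max_pairwise (solution_rel pr E) {..<n}"
    using inv round_invariant_Best_le[OF inv] sat_reached_fm[of ?s]
    by (simp add: round_invariant_def)
  then show ?thesis by (simp add: sem_decide)
qed

end

definition search_time :: "problem \<Rightarrow> nat \<Rightarrow> nat" where
  "search_time pr = round_time read_target (branch pr ;; next_subset) (Var Finished)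
     (decide Answer reached_fm)"

lemma (in graph_input) search_program_decides_within:
  "decides_within (search_program pr) w (p \<le> max_pairwise (solution_rel pr E) {..<n})
    (2 ^ card X * search_time pr n) (program_space (search_program pr) n)"
  unfolding search_program_def search_time_def
proof (rule complete_program_decides_within)
  show "round_store pr (2 ^ card X) (Var Finished) \<noteq> 0" by (simp add: round_store_Finished)
  show "round_store pr j (Var Finished) = 0" if "0 < j" "j < 2 ^ card X" for j
    using that by (simp add: round_store_Finished)
qed (simp_all add: input_unary round_store_def exec_decide_Answer[unfolded round_store_def])


section \<open>Encoded instances\<close>

lemma length_concat_rows: "length (concat (map (\<lambda>u. map (f u) vs) us)) = length us * length vs"
  by (induction us) simp_all

lemma nth_concat_rows:
  "i < length us \<Longrightarrow> j < length vs \<Longrightarrow>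
   concat (map (\<lambda>u. map (f u) vs) us) ! (i * length vs + j) = f (us ! i) (vs ! j)"
proof (induction us arbitrary: i)
  case (Cons u us)
  then show ?case by (cases i) (simp_all add: nth_append add.assoc)
qed simp

lemma input_symbol_append:
  "i < length xs \<Longrightarrow> input_symbol (xs @ ys) i = of_bool (xs ! i)"
  "input_symbol (xs @ ys) (length xs + i) = input_symbol ys i"
  by (simp_all add: input_symbol_def nth_append)

lemma less_bit_length_iff:
  assumes "0 < m"
  shows "j < bit_length m \<longleftrightarrow> 2 ^ j \<le> m"
proof
  assume "j < bit_length m"
  then have "(2::nat) ^ j \<le> 2 ^ floor_log m" by (simp add: bit_length_def)
  also have "\<dots> \<le> m" using assms by (rule floor_log_exp2_le)
  finally show "2 ^ j \<le> m" .
next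
  assume "2 ^ j \<le> m"
  then show "j < bit_length m"
    using floor_log_le_iff[of "2 ^ j" m] by (simp add: bit_length_def less_Suc_eq_le)
qed

lemma row_major_less:
  fixes n :: nat
  assumes "i < m" "j < n"
  shows "i * n + j < m * n"
proof -
  have "i * n + j < Suc i * n" using assms(2) by simp
  also have "\<dots> \<le> m * n" using assms(1) by (intro mult_le_mono1) simp
  finally show ?thesis .
qed

lemma input_symbol_encode_instance:
  fixes G X p
  defines "w \<equiv> encode_instance G X p" and "vs \<equiv> sorted_list_of_set (pverts G)"
    and "n \<equiv> card (pverts G)"
  shows "i \<le> n \<Longrightarrow> input_symbol w i = of_bool (i < n)"
    and "i < n \<Longrightarrow> j < n \<Longrightarrow>
      input_symbol w (cell_pos n i j) = of_bool ((vs ! i, vs ! j) \<in> parcs G)"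
    and "j < n \<Longrightarrow> input_symbol w (cell_pos n n j) = of_bool (vs ! j \<in> X)"
    and "0 < p \<Longrightarrow> input_symbol w (cell_pos n (Suc n) j) =
      (if p < 2 ^ j then 2 else of_bool (bit p j))"
proof -
  let ?unary = "replicate n True @ [False]"
  let ?rows = "concat (map (\<lambda>u. map (\<lambda>v. (u, v) \<in> parcs G) vs) vs)"
  let ?X = "map (\<lambda>v. v \<in> X) vs"
  let ?p = "map (bit p) [0..<bit_length p]"
  have n: "length vs = n" by (simp add: vs_def n_def)
  have w: "w = ?unary @ ?rows @ ?X @ ?p"
    by (simp add: w_def encode_instance_def Let_def vs_def n_def)
  have rows: "length ?rows = n * n" using n by (simp add: length_concat_rows)
  show "input_symbol w i = of_bool (i < n)" if "i \<le> n"
    unfolding w using that by (subst input_symbol_append(1)) (auto simp: nth_append)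
  have cell: "input_symbol w (cell_pos n i j) = input_symbol (?rows @ ?X @ ?p) (i * n + j)" for i j
    using input_symbol_append(2)[of ?unary "?rows @ ?X @ ?p" "i * n + j"]
    by (simp add: w cell_pos_def add.assoc)
  show "input_symbol w (cell_pos n i j) = of_bool ((vs ! i, vs ! j) \<in> parcs G)"
    if "i < n" "j < n"
    unfolding cell using that rows n row_major_less[OF that]
      nth_concat_rows[of i vs j vs "\<lambda>u v. (u, v) \<in> parcs G"]
    by (subst input_symbol_append(1)) simp_all
  have tail: "input_symbol w (cell_pos n n j) = input_symbol (?X @ ?p) j" for j
    unfolding cell using input_symbol_append(2)[of ?rows "?X @ ?p" j] rows by simp
  show "input_symbol w (cell_pos n n j) = of_bool (vs ! j \<in> X)" if "j < n"
    unfolding tail using that n by (subst input_symbol_append(1)) simp_all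
  have "cell_pos n (Suc n) j = cell_pos n n (n + j)" by (simp add: cell_pos_def)
  then have "input_symbol w (cell_pos n (Suc n) j) = input_symbol ?p j"
    using tail[of "n + j"] input_symbol_append(2)[of ?X ?p j] n by simp
  then show "input_symbol w (cell_pos n (Suc n) j) =
      (if p < 2 ^ j then 2 else of_bool (bit p j))" if "0 < p"
    using less_bit_length_iff[OF that, of j] by (simp add: input_symbol_def)
qed

lemma interval_representation_delete_verts:
  assumes "interval_graph (delete_verts (with_proj G) X)"
  obtains l r :: "'a \<Rightarrow> real"
  where "interval_representation (\<lambda>u v. (u, v) \<in> parcs G) (pverts G - X) l r"
proof -
  have "verts (delete_verts (with_proj G) X) = pverts G - X" by (simp add: delete_verts_def)
  moreover have "u \<rightarrow>\<^bsub>delete_verts (with_proj G) X\<^esub> v \<longleftrightarrow> (u, v) \<in> parcs G"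
    if "u \<in> pverts G - X" "v \<in> pverts G - X" for u v
    using that by (force simp: delete_verts_def arcs_ends_def arc_to_ends_def)
  ultimately show thesis
    using assms that unfolding interval_graph_def interval_representation_def
    by (metis (no_types, lifting))
qed

lemma bij_betw_nth_sorted_list_of_set:
  "finite A \<Longrightarrow> bij_betw ((!) (sorted_list_of_set A)) {..<card A} A"
  by (intro bij_betw_nth) simp_all

lemma graph_input_encode_instance:
  fixes G :: "nat pair_pre_digraph" and X p
  defines "n \<equiv> card (pverts G)" and "vs \<equiv> sorted_list_of_set (pverts G)"
  assumes G: "pair_graph G" and interval: "interval_graph (delete_verts (with_proj G) X)"
    and p: "0 < p"
  shows "graph_input (encode_instance G X p) n (\<lambda>i j. (vs ! i, vs ! j) \<in> parcs G)
    {i. i < n \<and> vs ! i \<in> X} p"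
proof -
  interpret pair_graph G by (rule G)
  have bij: "bij_betw ((!) vs) {..<n} (pverts G)"
    unfolding vs_def n_def by (intro bij_betw_nth_sorted_list_of_set pair_finite_verts)
  let ?rest = "{..<n} - {i. i < n \<and> vs ! i \<in> X}"
  obtain l r :: "nat \<Rightarrow> real"
    where "interval_representation (\<lambda>u v. (u, v) \<in> parcs G) (pverts G - X) l r"
    using interval by (rule interval_representation_delete_verts)
  moreover have "(!) vs ` ?rest \<subseteq> pverts G - X" using bij by (auto simp: bij_betw_def)
  ultimately have "interval_representation (\<lambda>u v. (u, v) \<in> parcs G) ((!) vs ` ?rest) l r"
    by (rule interval_representation_subset)
  moreover have "inj_on ((!) vs) ?rest" using bij by (auto simp: bij_betw_def intro: inj_on_subset)
  ultimately have "hereditarily_simplicial (\<lambda>i j. (vs ! i, vs ! j) \<in> parcs G) ?rest"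
    by (intro interval_representation_hereditarily_simplicial[OF interval_representation_comp])
      simp_all
  moreover have "symp (\<lambda>i j. (vs ! i, vs ! j) \<in> parcs G)"
    using pair_sym_arcs by (auto simp: symp_def symmetric_def dest: symD)
  moreover note input_symbol_encode_instance[where G = G and X = X and p = p, folded n_def vs_def]
  ultimately show ?thesis using p by unfold_locales auto
qed

definition is_solution :: "problem \<Rightarrow> 'a pair_pre_digraph \<Rightarrow> 'a set \<Rightarrow> bool" where
  "is_solution pr G S \<longleftrightarrow> S \<subseteq> pverts G \<and> pairwise (solution_rel pr (\<lambda>u v. (u, v) \<in> parcs G)) S"

lemma independent_in_iff: "independent_in (with_proj G) S \<longleftrightarrow> is_solution Independent_Set G S"
  by (auto simp: independent_in_def is_solution_def pairwise_def)

lemma clique_in_iff: "clique_in (with_proj G) S \<longleftrightarrow> is_solution Clique G S"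
  by (auto simp: clique_in_def is_solution_def pairwise_def)

lemma search_program_decides_instance:
  fixes G :: "nat pair_pre_digraph"
  assumes G: "pair_graph G" and X: "X \<subseteq> pverts G" "card X \<le> k"
    and interval: "interval_graph (delete_verts (with_proj G) X)" and p: "0 < p"
  shows "decides_within (search_program pr) (encode_instance G X p)
    (\<exists>S. is_solution pr G S \<and> card S = p)
    (2 ^ k * search_time pr (card (pverts G)))
    (program_space (search_program pr) (card (pverts G)))"
proof -
  define n where "n = card (pverts G)"
  define vs where "vs = sorted_list_of_set (pverts G)"
  let ?E = "\<lambda>i j. (vs ! i, vs ! j) \<in> parcs G" and ?X = "{i. i < n \<and> vs ! i \<in> X}"
  interpret pair_graph G by (rule G)
  interpret graph_input "encode_instance G X p" n ?E ?X p
    unfolding n_def vs_def using G interval p by (rule graph_input_encode_instance)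
  have bij: "bij_betw ((!) vs) {..<n} (pverts G)"
    unfolding vs_def n_def by (intro bij_betw_nth_sorted_list_of_set pair_finite_verts)
  have "(\<exists>S. is_solution pr G S \<and> card S = p) \<longleftrightarrow>
      (\<exists>S\<subseteq>pverts G. pairwise (solution_rel pr (\<lambda>u v. (u, v) \<in> parcs G)) S \<and> card S = p)"
    by (auto simp: is_solution_def)
  also have "\<dots> \<longleftrightarrow> (\<exists>S\<subseteq>{..<n}. pairwise (solution_rel pr ?E) S \<and> card S = p)"
    unfolding ex_pairwise_card_bij_betw[OF bij] by (cases pr) simp_all
  also have "\<dots> \<longleftrightarrow> p \<le> max_pairwise (solution_rel pr ?E) {..<n}"
    by (rule ex_pairwise_card_iff) simp
  finally have answer: "(\<exists>S. is_solution pr G S \<and> card S = p) \<longleftrightarrow> \<dots>" .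
  have "card ?X \<le> card X"
  proof (rule card_inj_on_le)
    show "inj_on ((!) vs) ?X" using bij by (auto simp: bij_betw_def intro: inj_on_subset)
  qed (use X pair_finite_verts in \<open>auto intro: finite_subset\<close>)
  then have "(2::nat) ^ card ?X \<le> 2 ^ k" using X(2) by (intro power_increasing) simp_all
  then show ?thesis
    unfolding answer n_def[symmetric]
    by (intro decides_within_mono[OF search_program_decides_within] mult_le_mono1) simp_all
qed

lemma solution_search_in_time:
  "\<exists>prog t s. poly_bounded t \<and> poly_bounded s \<and>
     (\<forall>(G :: nat pair_pre_digraph) X k p.
        pair_graph G \<and> X \<subseteq> pverts G \<and> card X \<le> k \<and>
        interval_graph (delete_verts (with_proj G) X) \<and> 0 < p \<longrightarrow>
        decides_within prog (encode_instance G X p)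
          (\<exists>S. is_solution pr G S \<and> card S = p)
          (2 ^ k * t (card (pverts G))) (s (card (pverts G))))"
proof (intro exI conjI allI impI)
  show "poly_bounded (search_time pr)"
    unfolding search_time_def by (rule poly_bounded_round_time)
  show "poly_bounded (program_space (search_program pr))" by (rule poly_bounded_program_space)
qed (auto intro: search_program_decides_instance)

theorem theorem5:
  shows
    "(\<exists>prog t s. poly_bounded t \<and> poly_bounded s \<and>
       (\<forall>(G :: nat pair_pre_digraph) X k p.
          pair_graph G \<and> X \<subseteq> pverts G \<and> card X \<le> k \<and>
          interval_graph (delete_verts (with_proj G) X) \<and> 0 < p \<longrightarrow>
          decides_within prog (encode_instance G X p)
            (\<exists>S. independent_in (with_proj G) S \<and> card S = p)
            (2 ^ k * t (card (pverts G)))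
            (s (card (pverts G)))))
     \<and>
     (\<exists>prog t s. poly_bounded t \<and> poly_bounded s \<and>
       (\<forall>(G :: nat pair_pre_digraph) X k p.
          pair_graph G \<and> X \<subseteq> pverts G \<and> card X \<le> k \<and>
          interval_graph (delete_verts (with_proj G) X) \<and> 0 < p \<longrightarrow>
          decides_within prog (encode_instance G X p)
            (\<exists>S. clique_in (with_proj G) S \<and> card S = p)
            (2 ^ k * t (card (pverts G)))
            (s (card (pverts G)))))"
  unfolding independent_in_iff clique_in_iff by (intro conjI solution_search_in_time)

end
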